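(* Let $U\subset\mathbb{R}$ be a neighborhood of the origin and let $c:U\to\mathbb{R}$ satisfy $c(0)=1$ and $c(\theta)>0$ for all $\theta\in U$. Let $\varphi\in C_b^2(\mathbb{R})$ and $\psi\in C_b^1(\mathbb{R})$. For $\varepsilon>0$ let $T^*=T^*(\varepsilon)$ be the lifespan (defined in the context) of the classical solution of $$u_{tt}-c(u_x)^2u_{xx}=0,\qquad u(0,x)=\varepsilon\varphi(x),\quad u_t(0,x)=\varepsilon\psi(x),\qquad x\in\mathbb{R}.$$ (a) Let $p>2$ and suppose that $c\in C^{\lceil p-2\rceil,\,p-\lceil p-1\rceil}(U)$ and $c'(0)=\cdots=c^{(\lceil p-2\rceil)}(0)=0$. Then there exist constants $\varepsilon_0>0$ and $C>0$, with $C$ independent of $\varepsilon$, such that $$C\varepsilon^{-(p-1)}\le T^*(\varepsilon)\qquad\text{for all }0<\varepsilon\le\varepsilon_0 .$$ (b) Suppose that $c\in C^1(U)$ and $c'(0)\neq0$. Then there exist constants $\varepsilon_0>0$ and $C>0$, with $C$ independent of $\varepsilon$, such that $$C\varepsilon^{-1}\le T^*(\varepsilon)\qquad\text{for all }0<\varepsilon\le\varepsilon_0 .$$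
   Context: $\lceil x\rceil$ is the least integer greater than or equal to $x$. $C^{m,\alpha}(U)$ is the class of $m$-times differentiable functions on $U$ whose $m$-th derivative is Hölder continuous with exponent $\alpha$ in $U$ (i.e. $|f^{(m)}(x)-f^{(m)}(y)|\le K|x-y|^\alpha$ on $U$ for some constant $K$). $C_b^m(\mathbb{R})$ is the set of $m$-times differentiable functions which, together with all their derivatives up to order $m$, are bounded and continuous on $\mathbb{R}$. Local-in-time existence and uniqueness of classical ($C^2$) solutions of the Cauchy problem is known for $\varphi\in C_b^2(\mathbb{R})$, $\psi\in C_b^1(\mathbb{R})$ (Courant–Lax, Hartman–Wintner, Douglis). The lifespan $T^*$ is the supremum of all $T>0$ such that the classical solution $u$ exists on $[0,T)\times\mathbb{R}$ with $$\sup_{t\in[0,T)}\bigl(\|u(t)\|_{L^\infty}+\|u_t(t)\|_{L^\infty}+\|u_x(t)\|_{L^\infty}+\|u_{tt}(t)\|_{L^\infty}+\|u_{tx}(t)\|_{L^\infty}+\|u_{xx}(t)\|_{L^\infty}\bigr)<\infty$$ and $\overline{u_x([0,T)\times\mathbb{R})}\subset U$. *)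

theory Defs
  imports "HOL-Probability.Essential_Supremum"
begin

text \<open>
  Functions on an open set \<open>U\<close> are total functions; \<open>(deriv ^^ k) f x\<close> at a point \<open>x\<close> of an open
  set depends only on the values of \<open>f\<close> near \<open>x\<close>, so values outside \<open>U\<close> play no role.
\<close>

definition times_differentiable_on :: "nat \<Rightarrow> (real \<Rightarrow> real) \<Rightarrow> real set \<Rightarrow> bool" where
  "times_differentiable_on m f U \<longleftrightarrow>
     (\<forall>k<m. \<forall>x\<in>U. (deriv ^^ k) f differentiable (at x))"

definition Holder_class :: "nat \<Rightarrow> real \<Rightarrow> real set \<Rightarrow> (real \<Rightarrow> real) set" where
  "Holder_class m \<alpha> U = {f. times_differentiable_on m f U \<and>
     (\<exists>K. \<forall>x\<in>U. \<forall>y\<in>U. \<bar>(deriv ^^ m) f x - (deriv ^^ m) f y\<bar> \<le> K * \<bar>x - y\<bar> powr \<alpha>)}"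

definition C_bounded :: "nat \<Rightarrow> (real \<Rightarrow> real) set" where
  "C_bounded m = {f. times_differentiable_on m f UNIV \<and>
     (\<forall>k\<le>m. bounded (range ((deriv ^^ k) f)) \<and> continuous_on UNIV ((deriv ^^ k) f))}"

definition Linf_norm :: "(real \<Rightarrow> real) \<Rightarrow> ereal" where
  "Linf_norm f = esssup lborel (\<lambda>x. ereal \<bar>f x\<bar>)"

text \<open>
  \<open>u\<close> is of class \<open>C\<^sup>2\<close> on the strip \<open>[0,T) \<times> \<real>\<close>, with the indicated partial derivatives
  (uniquely determined by \<open>u\<close> on the strip when \<open>T > 0\<close>).  Derivatives in \<open>t\<close> are one-sided
  at \<open>t = 0\<close>.  The two mixed derivatives are required to coincide, which for continuous
  mixed derivatives is no restriction.
\<close>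

definition C2_on_strip ::
  "real \<Rightarrow> (real \<Rightarrow> real \<Rightarrow> real) \<Rightarrow> (real \<Rightarrow> real \<Rightarrow> real) \<Rightarrow> (real \<Rightarrow> real \<Rightarrow> real) \<Rightarrow>
   (real \<Rightarrow> real \<Rightarrow> real) \<Rightarrow> (real \<Rightarrow> real \<Rightarrow> real) \<Rightarrow> (real \<Rightarrow> real \<Rightarrow> real) \<Rightarrow> bool" where
  "C2_on_strip T u ut ux utt utx uxx \<longleftrightarrow>
     (\<forall>t\<in>{0..<T}. \<forall>x.
        ((\<lambda>s. u s x) has_real_derivative ut t x) (at t within {0..<T}) \<and>
        ((\<lambda>y. u t y) has_real_derivative ux t x) (at x) \<and>
        ((\<lambda>s. ut s x) has_real_derivative utt t x) (at t within {0..<T}) \<and>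
        ((\<lambda>y. ut t y) has_real_derivative utx t x) (at x) \<and>
        ((\<lambda>s. ux s x) has_real_derivative utx t x) (at t within {0..<T}) \<and>
        ((\<lambda>y. ux t y) has_real_derivative uxx t x) (at x)) \<and>
     (\<forall>v\<in>{u, ut, ux, utt, utx, uxx}. continuous_on ({0..<T} \<times> UNIV) (\<lambda>(t, x). v t x))"

text \<open>
  The classical solution of \<open>u\<^sub>t\<^sub>t - c(u\<^sub>x)\<^sup>2 u\<^sub>x\<^sub>x = 0\<close> with \<open>u(0,\<cdot>) = f\<close>, \<open>u\<^sub>t(0,\<cdot>) = g\<close> exists on
  \<open>[0,T) \<times> \<real>\<close>, is bounded there together with its derivatives up to order two, and the closure
  of the range of \<open>u\<^sub>x\<close> lies in the domain \<open>U\<close> of \<open>c\<close>.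
\<close>

definition solvable_upto ::
  "real set \<Rightarrow> (real \<Rightarrow> real) \<Rightarrow> (real \<Rightarrow> real) \<Rightarrow> (real \<Rightarrow> real) \<Rightarrow> real \<Rightarrow> bool" where
  "solvable_upto U c f g T \<longleftrightarrow>
     (\<exists>u ut ux utt utx uxx. C2_on_strip T u ut ux utt utx uxx \<and>
        (\<forall>t\<in>{0..<T}. \<forall>x. utt t x - (c (ux t x))\<^sup>2 * uxx t x = 0) \<and>
        (\<forall>x. u 0 x = f x \<and> ut 0 x = g x) \<and>
        (SUP t\<in>{0..<T}. Linf_norm (u t) + Linf_norm (ut t) + Linf_norm (ux t)
           + Linf_norm (utt t) + Linf_norm (utx t) + Linf_norm (uxx t)) < \<infinity> \<and>
        closure ((\<lambda>(t, x). ux t x) ` ({0..<T} \<times> UNIV)) \<subseteq> U)"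

definition lifespan ::
  "real set \<Rightarrow> (real \<Rightarrow> real) \<Rightarrow> (real \<Rightarrow> real) \<Rightarrow> (real \<Rightarrow> real) \<Rightarrow> ereal" where
  "lifespan U c f g = Sup (ereal ` {T. T > 0 \<and> solvable_upto U c f g T})"

end

theory Submission imports Defs begin

text \<open>
  Let \<open>G\<close> be the primitive of \<open>c\<close> vanishing at the origin.  The Riemann invariants
  \<open>u\<^sub>t + G(u\<^sub>x)\<close> and \<open>u\<^sub>t - G(u\<^sub>x)\<close> are constant along the characteristics with speed \<open>- c(u\<^sub>x)\<close>
  and \<open>c(u\<^sub>x)\<close>.  Label the point where two characteristics meet by their feet \<open>a\<close> and \<open>b\<close> on
  the initial line.  In these coordinates the invariants, hence also the wave speed \<open>l(a, b)\<close>, are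
  known explicitly from the data, and \<open>t\<close> and \<open>x\<close> solve a linear hyperbolic system whose
  coefficients are the logarithmic derivatives of \<open>l\<close>.  Since \<open>c'(\<theta>) = O(\<bar>\<theta>\<bar>\<^sup>q\<^sup>-\<^sup>1)\<close> with
  \<open>q = p - 1\<close> or \<open>q = 1\<close>, these coefficients are of order \<open>\<epsilon>\<^sup>q\<close>, so on a strip
  \<open>\<bar>a - b\<bar> \<le> L\<close> with \<open>L\<close> a small multiple of \<open>\<epsilon>\<^sup>-\<^sup>q\<close> the map \<open>(a, b) \<mapsto> (t, x)\<close> is a small
  Lipschitz perturbation of \<open>((a - b) / 2, (a + b) / 2)\<close>.  It is therefore invertible over
  \<open>\<bar>t\<bar> < L / 4\<close>, and its inverse yields a classical solution there; no a priori local existence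
  theory is needed.
\<close>

subsection \<open>Oriented integrals\<close>

text \<open>
  Scaling to the unit interval makes the orientation, and joint continuity in the end points,
  automatic.
\<close>

definition oint :: "(real \<Rightarrow> real) \<Rightarrow> real \<Rightarrow> real \<Rightarrow> real" where
  "oint f a b = (b - a) * integral {0..1} (\<lambda>s. f (a + s * (b - a)))"

lemma oint_refl [simp]: "oint f a a = 0"
  by (simp add: oint_def)

lemma segment_point_mem:
  fixes a b s :: real
  assumes "convex S" "a \<in> S" "b \<in> S" "s \<in> {0..1}"
  shows "a + s * (b - a) \<in> S"
proof -
  have "(1 - s) *\<^sub>R a + s *\<^sub>R b \<in> S"
    using assms by (intro convexD_alt) auto
  then show ?thesis by (simp add: algebra_simps)
qed

text \<open>The affine path from \<open>a\<close> to \<open>b\<close> reduces this to the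
  fundamental theorem on the unit interval, whichever end point is larger. Derivatives within
  \<open>S\<close> suffice, so \<open>S\<close> may be a closed interval.\<close>

lemma oint_eq_diff:
  assumes "convex S" "a \<in> S" "b \<in> S"
    and "\<And>x. x \<in> S \<Longrightarrow> (F has_real_derivative f x) (at x within S)"
  shows "oint f a b = F b - F a"
proof -
  have "((\<lambda>s. f (a + s * (b - a)) * (b - a)) has_integral
           F (a + 1 * (b - a)) - F (a + 0 * (b - a))) {0..1}"
  proof (rule fundamental_theorem_of_calculus)
    fix s :: real assume s: "s \<in> {0..1}"
    have "((\<lambda>s. a + s * (b - a)) has_real_derivative (b - a)) (at s within {0..1})"
      by (auto intro!: derivative_eq_intros)
    moreover have "(F has_real_derivative f (a + s * (b - a)))
        (at (a + s * (b - a)) within (\<lambda>s. a + s * (b - a)) ` {0..1})"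
      by (rule DERIV_subset[OF assms(4)]) (use segment_point_mem[OF assms(1-3)] s in auto)
    ultimately have "((F \<circ> (\<lambda>s. a + s * (b - a))) has_real_derivative
        f (a + s * (b - a)) * (b - a)) (at s within {0..1})"
      by (intro DERIV_image_chain) auto
    then show "((\<lambda>s. F (a + s * (b - a))) has_vector_derivative f (a + s * (b - a)) * (b - a))
        (at s within {0..1})"
      by (simp add: has_real_derivative_iff_has_vector_derivative o_def)
  qed auto
  from integral_unique[OF this] show ?thesis
    unfolding oint_def by (simp add: mult.commute)
qed

text \<open>Puts both points in the interior of one compact interval inside \<open>S\<close>, so
  that an antiderivative on that interval has a two-sided derivative at either point.\<close>

lemma interval_sandwich:
  fixes a b :: real
  assumes "open S" "convex S" "a \<in> S" "b \<in> S"
  obtains l h where "l < a" "l < b" "a < h" "b < h" "{l..h} \<subseteq> S"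
proof -
  obtain d where d: "d > 0" "cball a d \<subseteq> S" using assms open_contains_cball by blast
  obtain e where e: "e > 0" "cball b e \<subseteq> S" using assms open_contains_cball by blast
  let ?l = "min (a - d) (b - e)" and ?h = "max (a + d) (b + e)"
  have "a - d \<in> S" "a + d \<in> S" "b - e \<in> S" "b + e \<in> S"
    using d e by (auto simp: cball_def dist_real_def)
  then have "?l \<in> S" "?h \<in> S" by (auto simp: min_def max_def)
  then have "{?l..?h} \<subseteq> S"
    using assms(2) by (meson atLeastAtMost_iff is_interval_1 is_interval_convex_1 subsetI)
  then show thesis using d e by (intro that[of ?l ?h]) auto
qed

lemma oint_has_derivative:
  assumes "open S" "convex S" "a \<in> S" "b \<in> S" "continuous_on S f"
  shows "((\<lambda>x. oint f a x) has_real_derivative f b) (at b)"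
proof -
  obtain l h where lh: "l < a" "l < b" "a < h" "b < h" "{l..h} \<subseteq> S"
    using interval_sandwich[OF assms(1-4)] by blast
  obtain G where G: "\<And>x. x \<in> {l..h} \<Longrightarrow> (G has_vector_derivative f x) (at x within {l..h})"
    using antiderivative_continuous[OF continuous_on_subset[OF assms(5) lh(5)]] by blast
  then have G': "\<And>x. x \<in> {l..h} \<Longrightarrow> (G has_real_derivative f x) (at x within {l..h})"
    by (simp add: has_real_derivative_iff_has_vector_derivative)
  have eq: "oint f a x = G x - G a" if "x \<in> {l..h}" for x
    using that lh G' by (intro oint_eq_diff[where S="{l..h}"]) auto
  have "(G has_real_derivative f b) (at b)"
    using G'[of b] lh at_within_interior[of b "{l..h}"] by auto
  then have "((\<lambda>x. G x - G a) has_real_derivative f b) (at b)"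
    by (auto intro!: derivative_eq_intros)
  then show ?thesis
  proof (rule has_field_derivative_transform_within_open)
    show "open {l<..<h}" "b \<in> {l<..<h}" using lh by auto
    show "\<And>x. x \<in> {l<..<h} \<Longrightarrow> G x - G a = oint f a x" using eq by auto
  qed
qed

lemma oint_split:
  assumes "continuous_on UNIV f"
  shows "oint f a b = oint f 0 b - oint f 0 a"
  by (rule oint_eq_diff[where S=UNIV])
    (use assms in \<open>auto intro: oint_has_derivative[where S=UNIV]\<close>)

lemma oint_has_derivative':
  assumes "continuous_on UNIV f"
  shows "((\<lambda>x. oint f a x) has_real_derivative f b) (at b within X)"
  using oint_has_derivative[where S=UNIV and f=f and a=a and b=b] assms
  by (auto intro: has_field_derivative_at_within)

lemma continuous_on_oint:
  fixes f :: "'a::topological_space \<Rightarrow> real \<Rightarrow> real"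
  assumes f: "continuous_on (X \<times> S) (\<lambda>(x, s). f x s)" and S: "convex S"
    and ab: "continuous_on X a" "continuous_on X b" "\<And>x. x \<in> X \<Longrightarrow> a x \<in> S" "\<And>x. x \<in> X \<Longrightarrow> b x \<in> S"
  shows "continuous_on X (\<lambda>x. oint (f x) (a x) (b x))"
proof -
  have fst: "continuous_on (X \<times> {0..1::real}) (\<lambda>z. g (fst z))"
    if "continuous_on X g" for g :: "'a \<Rightarrow> real"
    by (rule continuous_on_compose2[OF that]) (auto intro!: continuous_intros)
  have "continuous_on (X \<times> cbox 0 1) (\<lambda>z. (\<lambda>(x, s). f x s) (fst z, a (fst z) + snd z * (b (fst z) - a (fst z))))"
    by (rule continuous_on_compose2[OF f])
      (use segment_point_mem[OF S] ab in \<open>auto intro!: continuous_intros fst simp del: atLeastAtMost_iff simp: cbox_interval\<close>)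
  then have "continuous_on X (\<lambda>x. integral (cbox 0 1) (\<lambda>s. f x (a x + s * (b x - a x))))"
    by (intro integral_continuous_on_param) (simp add: case_prod_unfold)
  then show ?thesis
    unfolding oint_def using ab by (auto intro!: continuous_intros)
qed

lemma oint_integrable:
  fixes f :: "real \<Rightarrow> real"
  assumes "convex S" "a \<in> S" "b \<in> S" "continuous_on S f"
  shows "(\<lambda>s. f (a + s * (b - a))) integrable_on {0..1}"
proof -
  have "continuous_on {0..1} (\<lambda>s. f (a + s * (b - a)))"
    by (rule continuous_on_compose2[OF assms(4)])
      (use segment_point_mem[OF assms(1-3)] in \<open>auto intro!: continuous_intros\<close>)
  then show ?thesis by (intro integrable_continuous_real)
qed

lemma oint_bound:
  assumes "convex S" "a \<in> S" "b \<in> S" "continuous_on S f" "\<And>x. x \<in> S \<Longrightarrow> \<bar>f x\<bar> \<le> B"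
  shows "\<bar>oint f a b\<bar> \<le> B * \<bar>b - a\<bar>"
proof -
  have "norm (integral {0..1} (\<lambda>s. f (a + s * (b - a)))) \<le> integral {0..1} (\<lambda>s::real. B)"
    by (rule integral_norm_bound_integral[OF oint_integrable[OF assms(1-4)]])
      (use segment_point_mem[OF assms(1-3)] assms(5) in auto)
  then show ?thesis
    unfolding oint_def by (simp add: abs_mult mult.commute[of B] mult_left_mono)
qed

lemma oint_diff:
  assumes "continuous_on UNIV f" "continuous_on UNIV g"
  shows "oint f a b - oint g a b = oint (\<lambda>x. f x - g x) a b"
  unfolding oint_def right_diff_distrib[symmetric, of "b - a" "integral _ _"]
  by (subst integral_diff) (use assms in \<open>auto intro!: oint_integrable[where S=UNIV]\<close>)

lemma oint_uminus: "oint (\<lambda>x. - f x) a b = - oint f a b"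
  by (simp add: oint_def)

lemma oint_leibniz:
  assumes X: "convex X" "x \<in> X" and S: "convex S" "a \<in> S" "b \<in> S"
    and f: "\<And>x s. x \<in> X \<Longrightarrow> s \<in> S \<Longrightarrow> ((\<lambda>x. f x s) has_real_derivative fx x s) (at x within X)"
    and c: "\<And>x. x \<in> X \<Longrightarrow> continuous_on S (f x)"
    and cx: "continuous_on (X \<times> S) (\<lambda>(x, s). fx x s)"
  shows "((\<lambda>x. oint (f x) a b) has_real_derivative oint (fx x) a b) (at x within X)"
  unfolding oint_def
proof (rule DERIV_cmult)
  have "((\<lambda>x. integral (cbox 0 1) (\<lambda>s. f x (a + s * (b - a)))) has_real_derivative
     integral (cbox 0 1) (\<lambda>s. fx x (a + s * (b - a)))) (at x within X)"
  proof (rule leibniz_rule_field_derivative)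
    have "continuous_on (X \<times> cbox 0 1) (\<lambda>z. (\<lambda>(x, s). fx x s) (fst z, a + snd z * (b - a)))"
      by (rule continuous_on_compose2[OF cx])
        (use segment_point_mem[OF S] in \<open>auto intro!: continuous_intros\<close>)
    then show "continuous_on (X \<times> cbox 0 1) (\<lambda>(x, s). fx x (a + s * (b - a)))"
      by (simp add: case_prod_unfold)
  qed (use X segment_point_mem[OF S] f oint_integrable[OF S c] in auto)
  then show "((\<lambda>x. integral {0..1} (\<lambda>s. f x (a + s * (b - a)))) has_real_derivative
     integral {0..1} (\<lambda>s. fx x (a + s * (b - a)))) (at x within X)"
    by simp
qed

subsection \<open>Second-order equations in characteristic form\<close>

abbreviation cont2 :: "(real \<Rightarrow> real \<Rightarrow> real) \<Rightarrow> bool" where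
  "cont2 K \<equiv> continuous_on UNIV (\<lambda>(a, b). K a b)"

lemma cont2_compose:
  assumes "cont2 K" "continuous_on X f" "continuous_on X g"
  shows "continuous_on X (\<lambda>x. K (f x) (g x))"
  using continuous_on_compose2[OF assms(1) continuous_on_Pair[OF assms(2,3)]] by auto

lemma cont2_oint:
  assumes "cont2 K"
  shows "cont2 (\<lambda>a b. oint (K a) a b)" and "cont2 (\<lambda>a b. oint (\<lambda>s. K s b) b a)"
  using assms unfolding case_prod_unfold
  by (intro continuous_on_oint[where S=UNIV];
      auto intro!: continuous_intros cont2_compose[OF assms] simp: case_prod_unfold)+

text \<open>Solves \<open>w_ab = K\<close> with \<open>w_a = p\<close> and \<open>w_b = q\<close> on
  the diagonal: differentiating the first conclusion in \<open>b\<close>, or the second in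
  \<open>a\<close>, gives \<open>K a b\<close>, and for \<open>a = b\<close> the integrals
  vanish.\<close>

lemma diagonal_cauchy_problem:
  fixes K :: "real \<Rightarrow> real \<Rightarrow> real"
  assumes K: "cont2 K" and p: "continuous_on UNIV p" and q: "continuous_on UNIV q"
  obtains w where
    "\<And>a b. ((\<lambda>a. w a b) has_real_derivative p a + oint (K a) a b) (at a)"
    "\<And>a b. ((\<lambda>b. w a b) has_real_derivative q b + oint (\<lambda>s. K s b) b a) (at b)"
    "w 0 0 = 0"
proof -
  note KI = cont2_compose[OF K]
  \<comment> \<open>The double integral over the rectangle spanned by the origin and
    \<open>(a, b)\<close> produces the mixed derivative \<open>K\<close>. Subtracting the triangles
    between the axes and the diagonal moves the lower limits of the resulting integrals from
    \<open>0\<close> to the diagonal.\<close>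
  define w where "w a b =
    oint (\<lambda>s. p s - oint (K s) 0 s) 0 a + oint (\<lambda>s. q s - oint (\<lambda>r. K r s) 0 s) 0 b
    + oint (\<lambda>s. oint (K s) 0 b) 0 a" for a b
  have K1: "continuous_on X (\<lambda>s. oint (K s) 0 (f s))" if "continuous_on X f" for X and f :: "real \<Rightarrow> real"
    using that by (intro continuous_on_oint[where S=UNIV])
      (auto intro!: continuous_intros KI simp: case_prod_unfold)
  have K2: "continuous_on UNIV (\<lambda>s. oint (\<lambda>r. K r s) 0 s)"
    by (intro continuous_on_oint[where S=UNIV])
      (auto intro!: continuous_intros KI simp: case_prod_unfold)
  have l: "((\<lambda>b. oint (\<lambda>s. oint (K s) 0 b) 0 a) has_real_derivative oint (\<lambda>s. K s b) 0 a) (at b)" for a b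
    by (rule oint_leibniz[where X=UNIV and S=UNIV])
      (auto intro!: continuous_intros KI K1 oint_has_derivative' simp: case_prod_unfold)
  have da: "((\<lambda>a. w a b) has_real_derivative p a - oint (K a) 0 a + 0 + oint (K a) 0 b) (at a)" for a b
    unfolding w_def
    by (intro DERIV_add oint_has_derivative' DERIV_const) (auto intro!: continuous_intros K1 p)
  have db: "((\<lambda>b. w a b) has_real_derivative 0 + (q b - oint (\<lambda>r. K r b) 0 b) + oint (\<lambda>s. K s b) 0 a) (at b)" for a b
    unfolding w_def
    by (intro DERIV_add oint_has_derivative' DERIV_const l) (auto intro!: continuous_intros K2 q)
  show thesis
  proof
    show "((\<lambda>a. w a b) has_real_derivative p a + oint (K a) a b) (at a)" for a b
      using da[of b a] by (subst oint_split) (auto intro!: KI continuous_intros simp: algebra_simps)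
    show "((\<lambda>b. w a b) has_real_derivative q b + oint (\<lambda>s. K s b) b a) (at b)" for a b
      using db[of a b] by (subst oint_split) (auto intro!: KI continuous_intros simp: algebra_simps)
    show "w 0 0 = 0" by (simp add: w_def)
  qed
qed

text \<open>In the application \<open>F\<close> is minus the mixed derivative of the time
  coordinate, and the two bracketed factors are \<open>P\<close> and \<open>Q\<close>. Taking the
  mixed derivative as the unknown turns the hyperbolic equation into a fixed point equation for an
  integral operator, which contracts because \<open>\<kappa> * L\<close> is small.\<close>

lemma goursat_solution:
  fixes A B :: "real \<Rightarrow> real \<Rightarrow> real"
  assumes A: "cont2 A" "\<And>a b. \<bar>A a b\<bar> \<le> \<kappa>" and B: "cont2 B" "\<And>a b. \<bar>B a b\<bar> \<le> \<kappa>"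
    and p: "continuous_on UNIV p" "\<And>a. \<bar>p a\<bar> \<le> 1"
    and L: "0 \<le> L" "\<kappa> * L \<le> 1/8"
  obtains F where "cont2 F" "\<And>a b. \<bar>F a b\<bar> \<le> 4 * \<kappa>"
    "\<And>a b. \<bar>a - b\<bar> \<le> L \<Longrightarrow>
       F a b = A a b * (p a - oint (F a) a b) - B a b * (p b + oint (\<lambda>s. F s b) b a)"
proof -
  \<comment> \<open>clamping the length of the integration interval to \<open>L\<close> makes the integral operator a contraction
    on all of the plane, without changing it inside the strip\<close>
  define cl where "cl d = max (- L) (min L d)" for d :: real
  have cl: "\<bar>cl d\<bar> \<le> L" for d using L by (auto simp: cl_def)
  have cl_id: "cl d = d" if "\<bar>d\<bar> \<le> L" for d using that by (auto simp: cl_def)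
  have cl_cont: "continuous_on X (\<lambda>x. cl (f x))" if "continuous_on X f" for X :: "(real \<times> real) set" and f
    unfolding cl_def using that by (intro continuous_intros)
  have k0: "0 \<le> \<kappa>" using A(2)[of 0 0] by linarith
  define I where "I G a b = oint (\<lambda>s. G (a, s)) a (a + cl (b - a))" for G :: "real \<times> real \<Rightarrow> real" and a b
  define J where "J G a b = oint (\<lambda>s. G (s, b)) b (b + cl (a - b))" for G :: "real \<times> real \<Rightarrow> real" and a b
  define T where "T G = (\<lambda>(a, b). A a b * (p a - I G a b) - B a b * (p b + J G a b))" for G
  have GI: "continuous_on X (\<lambda>x. G (f x))" if "continuous_on UNIV G" "continuous_on X f"
    for G :: "real \<times> real \<Rightarrow> real" and X :: "'x::topological_space set" and f
    using continuous_on_compose2[OF that] by auto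
  have I_cont: "cont2 (I G)" if "continuous_on UNIV G" for G
    unfolding I_def case_prod_unfold
    by (rule continuous_on_oint[where S=UNIV])
      (auto intro!: continuous_intros cl_cont GI[OF that] simp: case_prod_unfold)
  have J_cont: "cont2 (J G)" if "continuous_on UNIV G" for G
    unfolding J_def case_prod_unfold
    by (rule continuous_on_oint[where S=UNIV])
      (auto intro!: continuous_intros cl_cont GI[OF that] simp: case_prod_unfold)
  have I_bound: "\<bar>I G a b\<bar> \<le> c * L" if "continuous_on UNIV G" "\<And>z. \<bar>G z\<bar> \<le> c" for G c a b
  proof -
    have "\<bar>I G a b\<bar> \<le> c * \<bar>a + cl (b - a) - a\<bar>"
      unfolding I_def by (rule oint_bound[where S=UNIV]) (auto intro!: GI continuous_intros that)
    moreover have "c \<ge> 0" using that(2)[of 0] by linarith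
    ultimately show ?thesis using cl[of "b - a"] by (smt (verit) mult_left_mono)
  qed
  have J_bound: "\<bar>J G a b\<bar> \<le> c * L" if "continuous_on UNIV G" "\<And>z. \<bar>G z\<bar> \<le> c" for G c a b
  proof -
    have "\<bar>J G a b\<bar> \<le> c * \<bar>b + cl (a - b) - b\<bar>"
      unfolding J_def by (rule oint_bound[where S=UNIV]) (auto intro!: GI continuous_intros that)
    moreover have "c \<ge> 0" using that(2)[of 0] by linarith
    ultimately show ?thesis using cl[of "a - b"] by (smt (verit) mult_left_mono)
  qed
  have T_cont: "continuous_on UNIV (T G)" if "continuous_on UNIV G" for G
    unfolding T_def case_prod_unfold
    by (intro continuous_intros cont2_compose[OF A(1)] cont2_compose[OF B(1)]
        cont2_compose[OF I_cont[OF that]] cont2_compose[OF J_cont[OF that]] continuous_on_compose2[OF p(1)] subset_UNIV)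
  have lin: "\<bar>A a b * x - B a b * y\<bar> \<le> \<kappa> * (2 * c)" if "\<bar>x\<bar> \<le> c" "\<bar>y\<bar> \<le> c" for a b x y c
  proof -
    have "\<bar>A a b * x\<bar> \<le> \<kappa> * c" "\<bar>B a b * y\<bar> \<le> \<kappa> * c"
      unfolding abs_mult using that A(2)[of a b] B(2)[of a b] by (auto intro!: mult_mono)
    then show ?thesis by linarith
  qed
  have T_bound: "\<bar>T G z\<bar> \<le> \<kappa> * (2 * (1 + c * L))" if "continuous_on UNIV G" "\<And>z. \<bar>G z\<bar> \<le> c" for G c z
    unfolding T_def case_prod_unfold
    by (rule lin) (use I_bound[OF that, of "fst z" "snd z"] J_bound[OF that, of "fst z" "snd z"]
        p(2)[of "fst z"] p(2)[of "snd z"] in linarith)+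
  have T_diff: "\<bar>T G z - T H z\<bar> \<le> c / 2"
    if "continuous_on UNIV G" "continuous_on UNIV H" "\<And>z. \<bar>G z - H z\<bar> \<le> c" for G H c z
  proof -
    obtain a b where z: "z = (a, b)" by (cases z)
    have i: "I G a b - I H a b = I (\<lambda>z. G z - H z) a b"
      unfolding I_def by (rule oint_diff) (auto intro!: GI continuous_intros that)
    have j: "J G a b - J H a b = J (\<lambda>z. G z - H z) a b"
      unfolding J_def by (rule oint_diff) (auto intro!: GI continuous_intros that)
    have cc: "continuous_on UNIV (\<lambda>z. G z - H z)" by (intro continuous_intros that)
    have "T G z - T H z = A a b * (- (I G a b - I H a b)) - B a b * (J G a b - J H a b)"
      by (simp add: T_def z algebra_simps)
    also have "\<bar>\<dots>\<bar> \<le> \<kappa> * (2 * (c * L))"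
      unfolding i j
      by (rule lin) (use I_bound[OF cc, of c a b] J_bound[OF cc, of c a b] that(3) in auto)
    also have "\<dots> = (\<kappa> * L) * (2 * c)" by simp
    also have "\<dots> \<le> 1/8 * (2 * c)"
      using that(3)[of z] by (intro mult_right_mono L(2)) auto
    finally show ?thesis using that(3)[of z] by linarith
  qed
  \<comment> \<open>Bounded continuous functions form a complete space in the supremum norm.
    \<open>T\<close> maps this space to itself, so Banach's theorem applies to
    \<open>\<Gamma>\<close>.\<close>
  define \<Gamma> where "\<Gamma> G = Bcontfun (T (apply_bcontfun G))" for G
  have \<Gamma>: "apply_bcontfun (\<Gamma> G) = T (apply_bcontfun G)" for G
  proof -
    have "\<bar>apply_bcontfun G z\<bar> \<le> norm G" for z using norm_bounded[of G z] by simp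
    then have "norm (T (apply_bcontfun G) z) \<le> \<kappa> * (2 * (1 + norm G * L))" for z
      using T_bound[of "apply_bcontfun G" "norm G" z] by simp
    then have "T (apply_bcontfun G) \<in> bcontfun"
      by (intro bcontfun_normI[where b="\<kappa> * (2 * (1 + norm G * L))"] T_cont) auto
    then show ?thesis by (simp add: \<Gamma>_def Bcontfun_inverse)
  qed
  have "\<exists>!G. \<Gamma> G = G"
  proof (rule banach_fix_type[where c="1/2"])
    show "\<forall>G H. dist (\<Gamma> G) (\<Gamma> H) \<le> 1/2 * dist G H"
    proof (intro allI dist_bound)
      fix G H :: "(real \<times> real) \<Rightarrow>\<^sub>C real" and z
      have "\<bar>apply_bcontfun G z - apply_bcontfun H z\<bar> \<le> dist G H" for z
        using dist_bounded[of G z H] by (simp add: dist_real_def)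
      then show "dist (apply_bcontfun (\<Gamma> G) z) (apply_bcontfun (\<Gamma> H) z) \<le> 1/2 * dist G H"
        using T_diff[of "apply_bcontfun G" "apply_bcontfun H" "dist G H" z] by (simp add: \<Gamma> dist_real_def)
    qed
  qed auto
  then obtain G where "\<Gamma> G = G" by blast
  then have fp: "apply_bcontfun G z = T (apply_bcontfun G) z" for z using \<Gamma>[of G] by simp
  define F where "F = (\<lambda>a b. apply_bcontfun G (a, b))"
  have Fc: "cont2 F" by (simp add: F_def case_prod_unfold)
  have "\<bar>apply_bcontfun G z\<bar> \<le> norm G" for z using norm_bounded[of G z] by simp
  then have "norm (apply_bcontfun G z) \<le> \<kappa> * (2 * (1 + norm G * L))" for z
    using T_bound[of "apply_bcontfun G" "norm G" z] fp[of z] by simp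
  \<comment> \<open>The bound on \<open>T\<close> is applied to the fixed point itself. By
    \<open>\<kappa> * L \<le> 1/8\<close> the term with \<open>norm G\<close> on the right is at
    most a quarter of \<open>norm G\<close> and can be absorbed.\<close>
  then have "norm G \<le> \<kappa> * (2 * (1 + norm G * L))" by (rule norm_bound)
  also have "\<dots> = 2 * \<kappa> + (\<kappa> * L) * (2 * norm G)" by (simp add: algebra_simps)
  also have "\<dots> \<le> 2 * \<kappa> + 1/8 * (2 * norm G)"
    by (intro add_left_mono mult_right_mono L(2)) auto
  finally have "norm G \<le> 4 * \<kappa>" using k0 by simp
  then have "\<bar>F a b\<bar> \<le> 4 * \<kappa>" for a b
    using norm_bounded[of G "(a, b)"] by (simp add: F_def)
  moreover have "F a b = A a b * (p a - oint (F a) a b) - B a b * (p b + oint (\<lambda>s. F s b) b a)"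
    if "\<bar>a - b\<bar> \<le> L" for a b
  proof -
    have "cl (b - a) = b - a" "cl (a - b) = a - b" using that by (auto intro!: cl_id)
    then show ?thesis using fp[of "(a, b)"] by (simp add: F_def T_def I_def J_def)
  qed
  ultimately show thesis using that[of F] Fc by blast
qed

subsection \<open>Gradients in the plane\<close>

abbreviation has_grad :: "(real \<times> real \<Rightarrow> real) \<Rightarrow> real \<Rightarrow> real \<Rightarrow> real \<times> real \<Rightarrow> bool" where
  "has_grad f p q z \<equiv> (f has_derivative (\<lambda>h. p * fst h + q * snd h)) (at z)"

lemma has_grad_partials:
  assumes "has_grad f p q (a, b)"
  shows "((\<lambda>s. f (s, b)) has_real_derivative p) (at a)"
    and "((\<lambda>s. f (a, s)) has_real_derivative q) (at b)"
proof -
  have "((\<lambda>s. f (s, b)) has_derivative (\<lambda>h. p * fst (h, 0::real) + q * snd (h, 0::real))) (at a)"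
    by (rule has_derivative_compose[where f="\<lambda>s. (s, b)" and g=f])
      (use assms in \<open>auto intro!: derivative_eq_intros\<close>)
  then show "((\<lambda>s. f (s, b)) has_real_derivative p) (at a)"
    by (simp add: has_field_derivative_def)
  have "((\<lambda>s. f (a, s)) has_derivative (\<lambda>h. p * fst (0::real, h) + q * snd (0::real, h))) (at b)"
    by (rule has_derivative_compose[where f="\<lambda>s. (a, s)" and g=f])
      (use assms in \<open>auto intro!: derivative_eq_intros\<close>)
  then show "((\<lambda>s. f (a, s)) has_real_derivative q) (at b)"
    by (simp add: has_field_derivative_def)
qed

text \<open>For total differentiability it suffices that one of the two partial derivatives is
  continuous, hence the asymmetric hypotheses.\<close>

lemma has_grad_of_partials:
  assumes "\<And>a b. ((\<lambda>a. w a b) has_real_derivative wa a b) (at a)"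
    and wb: "\<And>a b. ((\<lambda>b. w a b) has_real_derivative wb a b) (at b)" "cont2 wb"
  shows "has_grad (\<lambda>z. w (fst z) (snd z)) (wa (fst z) (snd z)) (wb (fst z) (snd z)) z"
proof -
  obtain a b where z: "z = (a, b)" by (cases z)
  have "continuous_on UNIV (\<lambda>(a, b). blinfun_mult_right (wb a b))"
    using bounded_linear.continuous_on[OF bounded_linear_blinfun_mult_right wb(2)]
    by (simp add: case_prod_unfold)
  then have "continuous (at (a, b) within UNIV \<times> UNIV) (\<lambda>(a, b). blinfun_mult_right (wb a b))"
    by (simp add: continuous_on_eq_continuous_at)
  then have "((\<lambda>(a, b). w a b) has_derivative
      (\<lambda>(ta, tb). wa a b * ta + blinfun_mult_right (wb a b) tb)) (at (a, b) within UNIV \<times> UNIV)"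
    using assms(1)[of b a] wb(1)
    by (intro has_derivative_partialsI) (auto simp: has_field_derivative_def)
  then show ?thesis by (simp add: z case_prod_unfold)
qed

lemma has_grad_compose:
  assumes "has_grad w wa wb (\<alpha> z, \<beta> z)" "has_grad \<alpha> a1 a2 z" "has_grad \<beta> b1 b2 z"
  shows "has_grad (\<lambda>z. w (\<alpha> z, \<beta> z)) (wa * a1 + wb * b1) (wa * a2 + wb * b2) z"
proof -
  have "((\<lambda>z. w (\<alpha> z, \<beta> z)) has_derivative
     (\<lambda>h. wa * fst (a1 * fst h + a2 * snd h, b1 * fst h + b2 * snd h)
        + wb * snd (a1 * fst h + a2 * snd h, b1 * fst h + b2 * snd h))) (at z)"
    by (rule has_derivative_compose[where f="\<lambda>z. (\<alpha> z, \<beta> z)"])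
      (use assms in \<open>auto intro!: has_derivative_Pair\<close>)
  then show ?thesis by (simp add: algebra_simps)
qed

lemma has_grad_chain:
  assumes "(\<phi> has_real_derivative d) (at (\<alpha> z))" "has_grad \<alpha> p q z"
  shows "has_grad (\<lambda>z. \<phi> (\<alpha> z)) (d * p) (d * q) z"
  using has_derivative_compose[OF assms(2), of \<phi> "(*) d"] assms(1)
  by (simp add: has_field_derivative_def algebra_simps)

lemma has_grad_midpoint:
  assumes "has_grad f p q z" "has_grad g p' q' z"
  shows "has_grad (\<lambda>z. (f z + g z) / 2) ((p + p') / 2) ((q + q') / 2) z"
proof -
  have eq: "(f z + g z) / 2 = 1/2 * (f z + g z)" for z by simp
  show ?thesis unfolding eq
    by (rule has_derivative_eq_rhs[OF has_derivative_mult_right[OF has_derivative_add[OF assms]]])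
      (simp add: fun_eq_iff field_simps)
qed

lemma continuous_on_of_has_grad:
  assumes "\<And>z. z \<in> S \<Longrightarrow> has_grad f (p z) (q z) z"
  shows "continuous_on S f"
  using assms by (intro continuous_at_imp_continuous_on) (auto intro: has_derivative_continuous)

text \<open>Used to integrate along the diagonal, where the initial values of \<open>t\<close> and
  \<open>x\<close> are checked.\<close>

lemma has_grad_diagonal:
  assumes "has_grad (\<lambda>z. w (fst z) (snd z)) p q (a, a)"
  shows "((\<lambda>s. w s s) has_real_derivative p + q) (at a)"
proof -
  have "((\<lambda>s. w (fst (s, s)) (snd (s, s))) has_derivative (\<lambda>h. p * fst (h, h) + q * snd (h, h))) (at a)"
    by (rule has_derivative_compose[where f="\<lambda>s. (s, s)"])
      (use assms in \<open>auto intro!: derivative_eq_intros\<close>)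
  then show ?thesis by (simp add: has_field_derivative_def flip: distrib_right)
qed

text \<open>Mean value inequality; the factor 2 arises because both coordinates of the increment are
  bounded by its norm.\<close>

lemma lipschitz_of_grad_bound:
  fixes S :: "(real \<times> real) set"
  assumes "convex S" "\<And>z. z \<in> S \<Longrightarrow> has_grad e (e1 z) (e2 z) z"
    and "\<And>z. z \<in> S \<Longrightarrow> \<bar>e1 z\<bar> \<le> \<eta>" "\<And>z. z \<in> S \<Longrightarrow> \<bar>e2 z\<bar> \<le> \<eta>"
    and "z \<in> S" "z' \<in> S"
  shows "\<bar>e z - e z'\<bar> \<le> 2 * \<eta> * norm (z - z')"
proof -
  have "norm (e z - e z') \<le> 2 * \<eta> * norm (z - z')"
  proof (rule differentiable_bound[OF assms(1)])
    fix y assume y: "y \<in> S"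
    show "(e has_derivative (\<lambda>h. e1 y * fst h + e2 y * snd h)) (at y within S)"
      using assms(2)[OF y] by (rule has_derivative_at_withinI)
    show "onorm (\<lambda>h. e1 y * fst h + e2 y * snd h) \<le> 2 * \<eta>"
    proof (rule onorm_le)
      fix h :: "real \<times> real"
      have "\<bar>e1 y * fst h\<bar> \<le> \<eta> * norm h" "\<bar>e2 y * snd h\<bar> \<le> \<eta> * norm h"
        unfolding abs_mult
        using assms(3,4)[OF y] norm_fst_le[of "fst h" "snd h"] norm_snd_le[of "snd h" "fst h"]
        by (auto intro!: mult_mono)
      then show "norm (e1 y * fst h + e2 y * snd h) \<le> 2 * \<eta> * norm h"
        unfolding real_norm_def by linarith
    qed
  qed (use assms in auto)
  then show ?thesis by simp
qed

subsection \<open>Inverting a map close to a rotation on a strip\<close>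

text \<open>With \<open>t = (a - b) / 2 + et\<close> and \<open>x = (a + b) / 2 + ex\<close>,
  solving \<open>t = s\<close>, \<open>x = y\<close> for \<open>(a, b)\<close> is a fixed point
  problem whose nonlinear part has a small Lipschitz constant. The contraction principle gives a
  unique solution in the closed strip, Lipschitz in \<open>(s, y)\<close>, and its derivative is the
  inverse of the Jacobian matrix.\<close>

lemma strip_inverse:
  fixes t x ta tb xa xb :: "real \<Rightarrow> real \<Rightarrow> real"
  assumes t: "\<And>a b. ((\<lambda>a. t a b) has_real_derivative ta a b) (at a)"
      "\<And>a b. ((\<lambda>b. t a b) has_real_derivative tb a b) (at b)" "cont2 tb"
    and x: "\<And>a b. ((\<lambda>a. x a b) has_real_derivative xa a b) (at a)"
      "\<And>a b. ((\<lambda>b. x a b) has_real_derivative xb a b) (at b)" "cont2 xb"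
    and near: "\<And>a b. \<bar>a - b\<bar> \<le> L \<Longrightarrow> \<bar>ta a b - 1/2\<bar> \<le> 1/32 \<and> \<bar>tb a b + 1/2\<bar> \<le> 1/32 \<and>
      \<bar>xa a b - 1/2\<bar> \<le> 1/32 \<and> \<bar>xb a b - 1/2\<bar> \<le> 1/32"
    and t0: "\<And>a. t a a = 0" and x0: "\<And>a. x a a = a" and L: "0 < L"
  obtains \<alpha> \<beta> :: "real \<times> real \<Rightarrow> real" where
    "\<And>s y. \<bar>s\<bar> < L / 4 \<Longrightarrow> \<bar>\<alpha> (s, y) - \<beta> (s, y)\<bar> < L"
    "\<And>y. \<alpha> (0, y) = y" "\<And>y. \<beta> (0, y) = y"
    "\<And>s y a b J. \<bar>s\<bar> < L / 4 \<Longrightarrow> a = \<alpha> (s, y) \<Longrightarrow> b = \<beta> (s, y) \<Longrightarrow>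
       J = ta a b * xb a b - tb a b * xa a b \<Longrightarrow>
       has_grad \<alpha> (xb a b / J) (- tb a b / J) (s, y) \<and>
       has_grad \<beta> (- xa a b / J) (ta a b / J) (s, y)"
proof -
  define S where "S = {z :: real \<times> real. \<bar>fst z - snd z\<bar> \<le> L}"
  define et where "et z = t (fst z) (snd z) - (fst z - snd z) / 2" for z
  define ex where "ex z = x (fst z) (snd z) - (fst z + snd z) / 2" for z
  \<comment> \<open>The sum and the difference of the equations \<open>x = y\<close> and
    \<open>t = s\<close>, solved for \<open>a\<close> and \<open>b\<close> in their linear
    parts.\<close>
  define N where "N p z = (snd p + fst p - (ex z + et z), snd p - fst p - (ex z - et z))"
    for p z :: "real \<times> real"
  have S: "convex S" "closed S"
  proof -
    have eq: "S = {z. fst z - snd z \<le> L} \<inter> {z. snd z - fst z \<le> L}"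
      by (auto simp: S_def)
    have "convex {z :: real \<times> real. fst z - snd z \<le> L}" "convex {z :: real \<times> real. snd z - fst z \<le> L}"
      using convex_halfspace_le[of "(1, -1) :: real \<times> real" L] convex_halfspace_le[of "(-1, 1) :: real \<times> real" L]
      by (simp_all add: inner_prod_def algebra_simps)
    then show "convex S" unfolding eq by (rule convex_Int)
    show "closed S" unfolding eq by (intro closed_Int closed_Collect_le continuous_intros)
  qed
  have gt: "has_grad (\<lambda>z. t (fst z) (snd z)) (ta (fst z) (snd z)) (tb (fst z) (snd z)) z" for z
    by (rule has_grad_of_partials[OF t])
  have gx: "has_grad (\<lambda>z. x (fst z) (snd z)) (xa (fst z) (snd z)) (xb (fst z) (snd z)) z" for z
    by (rule has_grad_of_partials[OF x])
  have et: "\<bar>et z - et z'\<bar> \<le> 1/16 * norm (z - z')" if "z \<in> S" "z' \<in> S" for z z'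
  proof -
    have "has_grad et (ta (fst z) (snd z) - 1/2) (tb (fst z) (snd z) + 1/2) z" for z
      unfolding et_def by (rule has_derivative_eq_rhs, rule has_derivative_diff[OF gt])
        (auto intro!: derivative_eq_intros simp: fun_eq_iff field_simps)
    from lipschitz_of_grad_bound[OF S(1) this _ _ that, of "1/32"] near
    show ?thesis by (auto simp: S_def)
  qed
  have ex: "\<bar>ex z - ex z'\<bar> \<le> 1/16 * norm (z - z')" if "z \<in> S" "z' \<in> S" for z z'
  proof -
    have "has_grad ex (xa (fst z) (snd z) - 1/2) (xb (fst z) (snd z) - 1/2) z" for z
      unfolding ex_def by (rule has_derivative_eq_rhs, rule has_derivative_diff[OF gx])
        (auto intro!: derivative_eq_intros simp: fun_eq_iff field_simps)
    from lipschitz_of_grad_bound[OF S(1) this _ _ that, of "1/32"] near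
    show ?thesis by (auto simp: S_def)
  qed
  \<comment> \<open>\<open>et\<close> vanishes on the diagonal because \<open>t\<close> does, so it
    is controlled by a small multiple of |a - b|; this keeps \<open>N\<close> inside the
    strip.\<close>
  have et_small: "\<bar>et z\<bar> \<le> 1/16 * \<bar>fst z - snd z\<bar>" if "z \<in> S" for z
  proof -
    have "norm (z - (snd z, snd z)) = \<bar>fst z - snd z\<bar>"
      by (cases z) (simp add: norm_Pair)
    moreover have "(snd z, snd z) \<in> S" using L by (simp add: S_def)
    ultimately show ?thesis using et[OF that, of "(snd z, snd z)"] by (simp add: et_def t0)
  qed
  \<comment> \<open>Each component moves by at most twice the change of the parameter plus
    \<open>2 * 1/16\<close> times the change of \<open>z\<close>; adding the two components gives 4
    and 1/4.\<close>
  have N_lip: "norm (N p z - N p' z') \<le> 4 * norm (p - p') + 1/4 * norm (z - z')"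
    if "z \<in> S" "z' \<in> S" for p p' z z'
  proof -
    have "norm (N p z - N p' z') \<le> \<bar>fst (N p z - N p' z')\<bar> + \<bar>snd (N p z - N p' z')\<bar>"
      using norm_Pair_le[of "fst (N p z - N p' z')" "snd (N p z - N p' z')"]
      unfolding prod.collapse real_norm_def .
    moreover have "\<bar>fst p - fst p'\<bar> \<le> norm (p - p')" "\<bar>snd p - snd p'\<bar> \<le> norm (p - p')"
      using norm_fst_le[of "fst (p - p')" "snd (p - p')"] norm_snd_le[of "snd (p - p')" "fst (p - p')"]
      unfolding prod.collapse real_norm_def by auto
    moreover have "\<bar>fst (N p z - N p' z')\<bar> \<le>
        \<bar>fst p - fst p'\<bar> + \<bar>snd p - snd p'\<bar> + \<bar>et z - et z'\<bar> + \<bar>ex z - ex z'\<bar>"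
      "\<bar>snd (N p z - N p' z')\<bar> \<le>
        \<bar>fst p - fst p'\<bar> + \<bar>snd p - snd p'\<bar> + \<bar>et z - et z'\<bar> + \<bar>ex z - ex z'\<bar>"
      unfolding N_def fst_diff snd_diff fst_conv snd_conv by linarith+
    moreover have "n \<le> 4 * P + 1/4 * Z" if "n \<le> A + B" "p \<le> P" "q \<le> P"
      "A \<le> p + q + r + s" "B \<le> p + q + r + s" "r \<le> 1/16 * Z" "s \<le> 1/16 * Z"
      for n A B p q r s P Z :: real
      using that by linarith
    ultimately show ?thesis using et[OF that] ex[OF that] by blast
  qed
  have fixed: "t (fst z) (snd z) = s \<and> x (fst z) (snd z) = y" if "N (s, y) z = z" for s y z
  proof -
    have "snd (s, y) + fst (s, y) - (ex z + et z) = fst z" "snd (s, y) - fst (s, y) - (ex z - et z) = snd z"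
      using that by (auto simp: N_def prod_eq_iff)
    then show ?thesis by (simp add: et_def ex_def) argo
  qed
  \<comment> \<open>|2 s| < L/2 and 2 |et z| \<le> L/8 add up to less than \<open>L\<close>, so
    images lie strictly inside the strip. The restriction |s| < L/4 serves this estimate.\<close>
  have N_S: "\<bar>fst (N (s, y) z) - snd (N (s, y) z)\<bar> < L" if "\<bar>s\<bar> < L / 4" "z \<in> S" for s y z
  proof -
    have "fst (N (s, y) z) - snd (N (s, y) z) = 2 * s - 2 * et z" by (simp add: N_def)
    moreover have "\<bar>et z\<bar> \<le> 1/16 * L" using et_small[OF that(2)] that(2) by (simp add: S_def)
    ultimately show ?thesis using that(1) by linarith
  qed
  have ex1: "\<exists>!z. z \<in> S \<and> N (s, y) z = z" if "\<bar>s\<bar> < L / 4" for s y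
  proof -
    have "\<exists>!z\<in>S. N (s, y) z = z"
    proof (rule Banach_fix[where c="1/4"])
      show "complete S" using S(2) by (simp add: complete_eq_closed)
      show "S \<noteq> {}" using L by (auto simp: S_def intro!: exI[of _ 0])
      show "N (s, y) ` S \<subseteq> S" using N_S[OF that] by (force simp: S_def intro: less_imp_le)
      show "dist (N (s, y) z) (N (s, y) z') \<le> 1/4 * dist z z'" if "z \<in> S" "z' \<in> S" for z z'
        using N_lip[OF that, of "(s, y)" "(s, y)"] by (simp add: dist_norm)
    qed auto
    then show ?thesis by blast
  qed
  define \<Psi> where "\<Psi> p = (THE z. z \<in> S \<and> N p z = z)" for p
  have \<Psi>: "\<Psi> (s, y) \<in> S" "N (s, y) (\<Psi> (s, y)) = \<Psi> (s, y)" if "\<bar>s\<bar> < L / 4" for s y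
    using theI'[OF ex1[OF that, of y]] by (auto simp: \<Psi>_def)
  have \<Psi>_unique: "\<Psi> (s, y) = z" if "\<bar>s\<bar> < L / 4" "z \<in> S" "N (s, y) z = z" for s y z
    using ex1[OF that(1), of y] \<Psi>[OF that(1), of y] that by blast
  have \<Psi>0: "\<Psi> (0, y) = (y, y)" for y
    by (rule \<Psi>_unique) (use L in \<open>auto simp: S_def N_def et_def ex_def t0 x0\<close>)
  define D where "D = {p :: real \<times> real. \<bar>fst p\<bar> < L / 4}"
  have D_open: "open D" unfolding D_def by (intro open_Collect_less continuous_intros)
  \<comment> \<open>The constant is \<open>4 / (1 - 1/4)\<close>: the term
    \<open>1/4 * norm (\<Psi> p - \<Psi> p')\<close> is absorbed on the left.\<close>
  have lip: "norm (\<Psi> p - \<Psi> p') \<le> 16/3 * norm (p - p')" if "p \<in> D" "p' \<in> D" for p p'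
  proof -
    have "\<Psi> p \<in> S" "N p (\<Psi> p) = \<Psi> p" "\<Psi> p' \<in> S" "N p' (\<Psi> p') = \<Psi> p'"
      using \<Psi>[of "fst p" "snd p"] \<Psi>[of "fst p'" "snd p'"] that by (auto simp: D_def)
    then show ?thesis using N_lip[of "\<Psi> p" "\<Psi> p'" p p'] by simp
  qed
  have cont: "continuous (at p) \<Psi>" if "p \<in> D" for p
  proof -
    have "continuous_on D \<Psi>"
      by (rule lipschitz_on_continuous_on[of "16/3"], rule lipschitz_onI) (use lip in \<open>auto simp: dist_norm\<close>)
    then show ?thesis using that D_open by (simp add: continuous_on_eq_continuous_at)
  qed
  \<comment> \<open>The candidate is Cramer's rule for the Jacobian matrix; the Lipschitz bound
    supplies the continuity of \<open>\<Psi>\<close> that the rule for inverses requires.\<close>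
  have deriv: "(\<Psi> has_derivative (\<lambda>h. ((xb a b * fst h - tb a b * snd h) / J, (ta a b * snd h - xa a b * fst h) / J)))
     (at p)"
    if p: "p \<in> D" and ab: "\<Psi> p = (a, b)" and J: "J = ta a b * xb a b - tb a b * xa a b" for p a b J
  proof (rule has_derivative_inverse_basic[where f="\<lambda>z. (t (fst z) (snd z), x (fst z) (snd z))"
        and f'="\<lambda>h. (ta a b * fst h + tb a b * snd h, xa a b * fst h + xb a b * snd h)"])
    have "\<Psi> p \<in> S" using \<Psi>[of "fst p" "snd p"] p by (simp add: D_def)
    then have n: "\<bar>ta a b - 1/2\<bar> \<le> 1/32" "\<bar>tb a b + 1/2\<bar> \<le> 1/32"
      "\<bar>xa a b - 1/2\<bar> \<le> 1/32" "\<bar>xb a b - 1/2\<bar> \<le> 1/32"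
      using near[of a b] ab by (auto simp: S_def)
    \<comment> \<open>With these signs both products contribute positively to
      \<open>J\<close>.\<close>
    have "ta a b > 0" "tb a b < 0" "xa a b > 0" "xb a b > 0" using n by linarith+
    then have "ta a b * xb a b > 0" "tb a b * xa a b < 0"
      by (auto intro!: mult_pos_pos mult_neg_pos)
    then have J0: "J \<noteq> 0" using J by linarith
    show "((\<lambda>z. (t (fst z) (snd z), x (fst z) (snd z))) has_derivative
      (\<lambda>h. (ta a b * fst h + tb a b * snd h, xa a b * fst h + xb a b * snd h))) (at (\<Psi> p))"
      using has_derivative_Pair[OF gt[of "\<Psi> p"] gx[of "\<Psi> p"]] by (simp add: ab)
    show "bounded_linear (\<lambda>h. ((xb a b * fst h - tb a b * snd h) / J, (ta a b * snd h - xa a b * fst h) / J))"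
      unfolding divide_inverse
      by (intro bounded_linear_Pair bounded_linear_mult_const bounded_linear_sub
          bounded_linear_const_mult bounded_linear_fst bounded_linear_snd)
    show "(\<lambda>h. ((xb a b * fst h - tb a b * snd h) / J, (ta a b * snd h - xa a b * fst h) / J)) \<circ>
      (\<lambda>h. (ta a b * fst h + tb a b * snd h, xa a b * fst h + xb a b * snd h)) = id"
    proof
      fix h :: "real \<times> real"
      have "xb a b * (ta a b * fst h + tb a b * snd h) - tb a b * (xa a b * fst h + xb a b * snd h) = fst h * J"
        "ta a b * (xa a b * fst h + xb a b * snd h) - xa a b * (ta a b * fst h + tb a b * snd h) = snd h * J"
        by (simp_all add: J algebra_simps)
      then show "((\<lambda>h. ((xb a b * fst h - tb a b * snd h) / J, (ta a b * snd h - xa a b * fst h) / J)) \<circ>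
      (\<lambda>h. (ta a b * fst h + tb a b * snd h, xa a b * fst h + xb a b * snd h))) h = id h"
        using J0 by simp
    qed
    show "(t (fst (\<Psi> z)) (snd (\<Psi> z)), x (fst (\<Psi> z)) (snd (\<Psi> z))) = z" if "z \<in> D" for z
      using fixed[of "fst z" "snd z" "\<Psi> z"] \<Psi>(2)[of "fst z" "snd z"] that by (simp add: D_def)
  qed (use cont D_open p in auto)
  show thesis
  proof (rule that[of "\<lambda>p. fst (\<Psi> p)" "\<lambda>p. snd (\<Psi> p)"])
    show "\<bar>fst (\<Psi> (s, y)) - snd (\<Psi> (s, y))\<bar> < L" if "\<bar>s\<bar> < L / 4" for s y
      using N_S[OF that \<Psi>(1)[OF that]] \<Psi>(2)[OF that] by metis
    fix s y a b J
    assume "\<bar>s\<bar> < L / 4" "a = fst (\<Psi> (s, y))" "b = snd (\<Psi> (s, y))"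
      "J = ta a b * xb a b - tb a b * xa a b"
    then have d: "(\<Psi> has_derivative (\<lambda>h. ((xb a b * fst h - tb a b * snd h) / J, (ta a b * snd h - xa a b * fst h) / J)))
     (at (s, y))" by (intro deriv) (auto simp: D_def)
    show "has_grad (\<lambda>p. fst (\<Psi> p)) (xb a b / J) (- tb a b / J) (s, y) \<and>
       has_grad (\<lambda>p. snd (\<Psi> p)) (- xa a b / J) (ta a b / J) (s, y)"
      using has_derivative_fst[OF d] has_derivative_snd[OF d]
      by (simp add: diff_divide_distrib algebra_simps)
  qed (simp_all add: \<Psi>0)
qed

subsection \<open>Characteristic coordinates\<close>

text \<open>
  \<open>l\<close> is the wave speed as a function of the characteristic coordinates.  The functions \<open>P\<close>
  and \<open>Q\<close> are the derivatives \<open>t\<^sub>a\<close> and \<open>- t\<^sub>b\<close> of the time variable, and the relations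
  \<open>x\<^sub>a = l t\<^sub>a\<close>, \<open>x\<^sub>b = - l t\<^sub>b\<close> lead to \<open>2 l t\<^sub>a\<^sub>b + l\<^sub>b t\<^sub>a + l\<^sub>a t\<^sub>b = 0\<close>, with \<open>t = 0\<close> and \<open>x = a\<close>
  on the diagonal.
\<close>

lemma characteristic_coordinates:
  fixes l la lb :: "real \<Rightarrow> real \<Rightarrow> real"
  assumes la: "\<And>a b. ((\<lambda>a. l a b) has_real_derivative la a b) (at a)" "cont2 la"
    and lb: "\<And>a b. ((\<lambda>b. l a b) has_real_derivative lb a b) (at b)" "cont2 lb"
    and l: "cont2 l" "\<And>a b. \<bar>l a b - 1\<bar> \<le> 1/100"
    and k: "\<And>a b. \<bar>la a b\<bar> \<le> \<kappa>" "\<And>a b. \<bar>lb a b\<bar> \<le> \<kappa>"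
    and L: "0 < L" "\<kappa> * L \<le> 1/400"
  obtains \<alpha> \<beta> :: "real \<times> real \<Rightarrow> real" and P Q :: "real \<Rightarrow> real \<Rightarrow> real" where
    "cont2 P" "cont2 Q"
    "\<And>a b. \<bar>a - b\<bar> \<le> L \<Longrightarrow> \<bar>P a b - 1/2\<bar> \<le> 1/32" "\<And>a b. \<bar>a - b\<bar> \<le> L \<Longrightarrow> \<bar>Q a b - 1/2\<bar> \<le> 1/32"
    "\<And>s y. \<bar>s\<bar> < L / 4 \<Longrightarrow> \<bar>\<alpha> (s, y) - \<beta> (s, y)\<bar> \<le> L"
    "\<And>y. \<alpha> (0, y) = y" "\<And>y. \<beta> (0, y) = y"
    "\<And>s y a b. \<bar>s\<bar> < L / 4 \<Longrightarrow> a = \<alpha> (s, y) \<Longrightarrow> b = \<beta> (s, y) \<Longrightarrow>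
       has_grad \<alpha> (1 / (2 * P a b)) (1 / (2 * l a b * P a b)) (s, y) \<and>
       has_grad \<beta> (- 1 / (2 * Q a b)) (1 / (2 * l a b * Q a b)) (s, y)"
proof -

  \<comment> \<open>Coefficients and diagonal data\<close>
  have l_bounds: "99/100 \<le> l a b" "l a b \<le> 101/100" for a b using l(2)[of a b] by linarith+
  have l_pos: "l a b > 0" for a b using l_bounds(1)[of a b] by linarith
  then have l_nz: "l a b \<noteq> 0" for a b by (metis less_irrefl)
  have k0: "0 \<le> \<kappa>" using k(1)[of 0 0] by linarith
  \<comment> \<open>After division by \<open>2 * l\<close> the equation for \<open>t_ab\<close>
    reads \<open>F = A * P - B * Q\<close> with \<open>F = - t_ab\<close>.\<close>
  define A where "A = (\<lambda>a b. lb a b / (2 * l a b))"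
  define B where "B = (\<lambda>a b. la a b / (2 * l a b))"
  \<comment> \<open>On the diagonal \<open>t_a + t_b = 0\<close> and \<open>x_a + x_b = 1\<close>.
    Together with \<open>x_a = l * t_a\<close> and \<open>x_b = - l * t_b\<close> this forces
    \<open>t_a = 1 / (2 * l)\<close>.\<close>
  define p where "p a = 1 / (2 * l a a)" for a
  have l_comp: "continuous_on X (\<lambda>x. l (f x) (g x))" if "continuous_on X f" "continuous_on X g"
    for X :: "'x::topological_space set" and f g by (rule cont2_compose[OF l(1) that])
  have A: "cont2 A" and B: "cont2 B"
    unfolding A_def B_def case_prod_unfold
    by (auto intro!: continuous_intros cont2_compose[OF la(2)] cont2_compose[OF lb(2)] l_comp simp: l_nz)
  have AB_bound: "\<bar>A a b\<bar> \<le> \<kappa>" "\<bar>B a b\<bar> \<le> \<kappa>" for a b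
  proof -
    have "\<bar>m / (2 * l a b)\<bar> \<le> \<kappa>" if "\<bar>m\<bar> \<le> \<kappa>" for m
    proof -
      have "\<bar>m\<bar> \<le> \<kappa> * 1" using that by simp
      also have "\<dots> \<le> \<kappa> * (2 * l a b)" using l_bounds(1)[of a b] k0 by (intro mult_left_mono) auto
      finally show ?thesis using l_pos[of a b] by (simp add: abs_mult field_simps)
    qed
    then show "\<bar>A a b\<bar> \<le> \<kappa>" "\<bar>B a b\<bar> \<le> \<kappa>" using k[of a b] by (auto simp: A_def B_def)
  qed
  have p: "continuous_on UNIV p"
    unfolding p_def by (intro continuous_intros l_comp) (simp add: l_nz)
  have p_near: "\<bar>p a - 1/2\<bar> \<le> 1/190" for a
    unfolding abs_le_iff p_def using l_bounds[of a a] by (simp add: field_simps)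

  \<comment> \<open>Mixed derivative of the time coordinate\<close>
  obtain F where F: "cont2 F" "\<And>a b. \<bar>F a b\<bar> \<le> 4 * \<kappa>"
    "\<And>a b. \<bar>a - b\<bar> \<le> L \<Longrightarrow>
       F a b = A a b * (p a - oint (F a) a b) - B a b * (p b + oint (\<lambda>s. F s b) b a)"
  proof -
    have "\<bar>p a\<bar> \<le> 1" for a using p_near[of a] by linarith
    moreover have "0 \<le> L" "\<kappa> * L \<le> 1/8" using L by linarith+
    ultimately show ?thesis
      using goursat_solution[OF A AB_bound(1) B AB_bound(2) p] that by blast
  qed
  note FI = cont2_compose[OF F(1)]
  define P where "P a b = p a - oint (F a) a b" for a b
  define Q where "Q a b = p b + oint (\<lambda>s. F s b) b a" for a b
  have p_comp: "continuous_on X (\<lambda>x. p (f x))" if "continuous_on X f"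
    for X :: "(real \<times> real) set" and f using continuous_on_compose2[OF p that] by auto
  have PQ: "cont2 P" "cont2 Q"
    unfolding P_def Q_def case_prod_unfold
    by (intro continuous_intros p_comp cont2_oint[OF F(1), unfolded case_prod_unfold])+
  have PQ_near: "\<bar>P a b - 1/2\<bar> \<le> 1/60" "\<bar>Q a b - 1/2\<bar> \<le> 1/60" if "\<bar>a - b\<bar> \<le> L" for a b
  proof -
    have "4 * \<kappa> * \<bar>a - b\<bar> \<le> 4 * \<kappa> * L" using that k0 by (intro mult_left_mono) auto
    then have *: "4 * \<kappa> * \<bar>a - b\<bar> \<le> 1/100" using L(2) by simp
    have "\<bar>oint (F a) a b\<bar> \<le> 4 * \<kappa> * \<bar>b - a\<bar>" "\<bar>oint (\<lambda>s. F s b) b a\<bar> \<le> 4 * \<kappa> * \<bar>a - b\<bar>"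
      by (rule oint_bound[where S=UNIV]; auto intro!: FI continuous_intros F)+
    then show "\<bar>P a b - 1/2\<bar> \<le> 1/60" "\<bar>Q a b - 1/2\<bar> \<le> 1/60"
      using * p_near[of a] p_near[of b] unfolding P_def Q_def
      by (simp_all only: abs_minus_commute[of b a])
  qed

  \<comment> \<open>Construction of the coordinates \<open>t\<close> and \<open>x\<close>\<close>
  have F_eq: "2 * l a b * F a b = lb a b * P a b - la a b * Q a b" if "\<bar>a - b\<bar> \<le> L" for a b
  proof -
    have "2 * l a b * F a b = (2 * l a b * A a b) * P a b - (2 * l a b * B a b) * Q a b"
      unfolding F(3)[OF that, folded P_def Q_def] by (simp add: algebra_simps)
    then show ?thesis using l_nz[of a b] by (simp add: A_def B_def)
  qed
  \<comment> \<open>The intended mixed derivative of \<open>x\<close>: differentiating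
    \<open>x_a = l * t_a\<close> in \<open>b\<close> gives \<open>lb * P - l * F\<close>, which
    equals \<open>H\<close> by \<open>F_eq\<close>.\<close>
  define H where "H = (\<lambda>a b. (lb a b * P a b + la a b * Q a b) / 2)"
  have H: "cont2 H"
    unfolding H_def case_prod_unfold
    by (intro continuous_intros cont2_compose[OF la(2)] cont2_compose[OF lb(2)]
        cont2_compose[OF PQ(1)] cont2_compose[OF PQ(2)]) auto
  note HI = cont2_compose[OF H]
  obtain t where t: "\<And>a b. ((\<lambda>a. t a b) has_real_derivative p a + oint (\<lambda>s. - F a s) a b) (at a)"
    "\<And>a b. ((\<lambda>b. t a b) has_real_derivative - p b + oint (\<lambda>s. - F s b) b a) (at b)" "t 0 0 = 0"
    by (rule diagonal_cauchy_problem[of "\<lambda>a b. - F a b" p "\<lambda>b. - p b"])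
      (use F(1) p in \<open>auto intro!: continuous_intros simp: case_prod_unfold\<close>)
  have ta: "((\<lambda>a. t a b) has_real_derivative P a b) (at a)" for a b
    using t(1)[of b a] by (simp add: oint_uminus P_def)
  have tb: "((\<lambda>b. t a b) has_real_derivative - Q a b) (at b)" for a b
    using t(2)[of a b] by (simp add: oint_uminus Q_def)
  define X where "X a b = 1/2 + oint (H a) a b" for a b
  define Y where "Y a b = 1/2 + oint (\<lambda>s. H s b) b a" for a b
  obtain x where xa: "\<And>a b. ((\<lambda>a. x a b) has_real_derivative X a b) (at a)"
    and xb: "\<And>a b. ((\<lambda>b. x a b) has_real_derivative Y a b) (at b)" and x0: "x 0 0 = 0"
    using diagonal_cauchy_problem[OF H, of "\<lambda>_. 1/2" "\<lambda>_. 1/2"] unfolding X_def Y_def by auto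
  have Y: "cont2 Y"
    unfolding Y_def case_prod_unfold
    by (intro continuous_intros cont2_oint[OF H, unfolded case_prod_unfold])
  have mQ: "cont2 (\<lambda>a b. - Q a b)"
    using PQ(2) unfolding case_prod_unfold by (intro continuous_intros)
  have t_diag: "t a a = 0" for a
  proof -
    have "((\<lambda>s. t s s) has_real_derivative 0) (at s)" for s
      using has_grad_diagonal[OF has_grad_of_partials[OF ta tb mQ], of s] by (simp add: P_def Q_def)
    then show ?thesis using DERIV_isconst_all[of "\<lambda>s. t s s" a 0] t(3) by simp
  qed
  have x_diag: "x a a = a" for a
  proof -
    have "((\<lambda>s. x s s) has_real_derivative 1) (at s)" for s
      using has_grad_diagonal[OF has_grad_of_partials[OF xa xb Y], of s] by (simp add: X_def Y_def)
    then have "((\<lambda>s. x s s - s) has_real_derivative 0) (at s)" for s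
      by (auto intro!: derivative_eq_intros)
    then show ?thesis using DERIV_isconst_all[of "\<lambda>s. x s s - s" a 0] x0 by simp
  qed

  \<comment> \<open>The relations \<open>x_a = l * t_a\<close> and
    \<open>x_b = - l * t_b\<close>\<close>
  have strip_convex: "convex {b. \<bar>a - b\<bar> \<le> L}" for a
  proof -
    have "{b. \<bar>a - b\<bar> \<le> L} = {a - L..a + L}" by (auto simp: abs_le_iff)
    then show ?thesis by simp
  qed
  \<comment> \<open>\<open>x\<close> was built from \<open>H\<close> alone, so the relation
    \<open>x_a = l * t_a\<close> has to be proved: both sides agree on the diagonal and, inside the
    strip, where \<open>F_eq\<close> holds, have the same derivative in \<open>b\<close>.\<close>
  have X: "X a b = l a b * P a b" if "\<bar>a - b\<bar> \<le> L" for a b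
  proof -
    have d: "((\<lambda>b. X a b - l a b * P a b) has_real_derivative 0) (at b within {b. \<bar>a - b\<bar> \<le> L})"
      if "\<bar>a - b\<bar> \<le> L" for b
    proof -
      have "((\<lambda>b. X a b - l a b * P a b) has_real_derivative
          (0 + H a b) - (l a b * (0 - F a b) + lb a b * P a b)) (at b)"
        unfolding X_def P_def
        by (intro DERIV_diff DERIV_add DERIV_const DERIV_mult' lb oint_has_derivative' HI FI continuous_intros)
      moreover have "(0 + H a b) - (l a b * (0 - F a b) + lb a b * P a b) = 0"
        using F_eq[OF that] by (simp add: H_def field_simps)
      ultimately show ?thesis by (auto intro: has_field_derivative_at_within)
    qed
    have "\<exists>c. \<forall>b\<in>{b. \<bar>a - b\<bar> \<le> L}. X a b - l a b * P a b = c"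
      by (rule has_field_derivative_zero_constant[OF strip_convex]) (use d in auto)
    moreover have "X a a - l a a * P a a = 0" using l_nz[of a a] by (simp add: X_def P_def p_def)
    ultimately show ?thesis using that L(1) by force
  qed
  have Yq: "Y a b = l a b * Q a b" if "\<bar>a - b\<bar> \<le> L" for a b
  proof -
    have d: "((\<lambda>a. Y a b - l a b * Q a b) has_real_derivative 0) (at a within {a. \<bar>b - a\<bar> \<le> L})"
      if "\<bar>b - a\<bar> \<le> L" for a
    proof -
      have "((\<lambda>a. Y a b - l a b * Q a b) has_real_derivative
          (0 + H a b) - (l a b * (0 + F a b) + la a b * Q a b)) (at a)"
        unfolding Y_def Q_def
        by (intro DERIV_diff DERIV_add DERIV_const DERIV_mult' la
            oint_has_derivative'[where f="\<lambda>s. H s b"] oint_has_derivative'[where f="\<lambda>s. F s b"] HI FI continuous_intros)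
      moreover have "(0 + H a b) - (l a b * (0 + F a b) + la a b * Q a b) = 0"
        using F_eq[of a b] that by (simp add: H_def field_simps abs_minus_commute)
      ultimately show ?thesis by (auto intro: has_field_derivative_at_within)
    qed
    have "\<exists>c. \<forall>a\<in>{a. \<bar>b - a\<bar> \<le> L}. Y a b - l a b * Q a b = c"
      by (rule has_field_derivative_zero_constant[OF strip_convex]) (use d in auto)
    moreover have "Y b b - l b b * Q b b = 0" using l_nz[of b b] by (simp add: Y_def Q_def p_def)
    ultimately show ?thesis using that L(1) by (force simp: abs_minus_commute)
  qed
  \<comment> \<open>The errors 1/100 from the speed and 1/60 from \<open>P\<close> or
    \<open>Q\<close> together stay below the 1/32 allowed in \<open>strip_inverse\<close>.\<close>
  have lP_near: "\<bar>l a b * q - 1/2\<bar> \<le> 1/32" if "\<bar>q - 1/2\<bar> \<le> 1/60" for a b q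
  proof -
    have "l a b * q - 1/2 = (l a b - 1) * q + (q - 1/2)" by (simp add: algebra_simps)
    moreover have "\<bar>(l a b - 1) * q\<bar> \<le> 1/100 * 1"
      unfolding abs_mult
    proof (intro mult_mono l(2))
      show "\<bar>q\<bar> \<le> 1" using that by linarith
    qed auto
    ultimately show ?thesis using that by linarith
  qed
  have near: "\<bar>P a b - 1/2\<bar> \<le> 1/32 \<and> \<bar>- Q a b + 1/2\<bar> \<le> 1/32 \<and> \<bar>X a b - 1/2\<bar> \<le> 1/32 \<and> \<bar>Y a b - 1/2\<bar> \<le> 1/32"
    if "\<bar>a - b\<bar> \<le> L" for a b
  proof -
    have "\<bar>P a b - 1/2\<bar> \<le> 1/32" "\<bar>- Q a b + 1/2\<bar> \<le> 1/32" using PQ_near[OF that] by linarith+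
    then show ?thesis
      using PQ_near[OF that] lP_near[of "P a b" a b] lP_near[of "Q a b" a b] X[OF that] Yq[OF that] by simp
  qed

  \<comment> \<open>Inversion of the coordinate map\<close>
  obtain \<alpha> \<beta> :: "real \<times> real \<Rightarrow> real" where ab:
    "\<And>s y. \<bar>s\<bar> < L / 4 \<Longrightarrow> \<bar>\<alpha> (s, y) - \<beta> (s, y)\<bar> < L"
    "\<And>y. \<alpha> (0, y) = y" "\<And>y. \<beta> (0, y) = y"
    "\<And>s y a b J. \<bar>s\<bar> < L / 4 \<Longrightarrow> a = \<alpha> (s, y) \<Longrightarrow> b = \<beta> (s, y) \<Longrightarrow>
       J = P a b * Y a b - (- Q a b) * X a b \<Longrightarrow>
       has_grad \<alpha> (Y a b / J) (- (- Q a b) / J) (s, y) \<and>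
       has_grad \<beta> (- X a b / J) (P a b / J) (s, y)"
    using strip_inverse[OF ta tb mQ xa xb Y near t_diag x_diag L(1)] by blast
  have grads: "has_grad \<alpha> (1 / (2 * P a b)) (1 / (2 * l a b * P a b)) (s, y) \<and>
       has_grad \<beta> (- 1 / (2 * Q a b)) (1 / (2 * l a b * Q a b)) (s, y)"
    if s: "\<bar>s\<bar> < L / 4" and a: "a = \<alpha> (s, y)" and b: "b = \<beta> (s, y)" for s y a b
  proof -
    have st: "\<bar>a - b\<bar> \<le> L" using ab(1)[OF s, of y] a b by simp
    \<comment> \<open>The Jacobian determinant \<open>P * Y + Q * X\<close> after inserting
      \<open>X = l * P\<close> and \<open>Y = l * Q\<close>.\<close>
    define J where "J = 2 * l a b * P a b * Q a b"
    have "P a b \<noteq> 0" "Q a b \<noteq> 0" using PQ_near[OF st] by auto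
    then have "Y a b / J = 1 / (2 * P a b)" "- (- Q a b) / J = 1 / (2 * l a b * P a b)"
      "- X a b / J = - 1 / (2 * Q a b)" "P a b / J = 1 / (2 * l a b * Q a b)"
      using l_nz[of a b] by (simp_all add: J_def X[OF st] Yq[OF st] field_simps)
    moreover have "J = P a b * Y a b - (- Q a b) * X a b"
      by (simp add: J_def X[OF st] Yq[OF st] algebra_simps)
    note ab(4)[OF s a b this]
    ultimately show ?thesis by metis
  qed
  show thesis
    by (rule that[OF PQ _ _ _ ab(2,3) grads]) (use near ab(1) in \<open>auto simp: abs_minus_commute intro: less_imp_le\<close>)
qed

subsection \<open>Classical solutions from Riemann invariants\<close>

text \<open>The positive lower bound on the slope makes the primitive \<open>G\<close> expanding: it
  is injective with a Lipschitz inverse, and it grows enough in both directions to be onto.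
  Normalizing \<open>G\<close> to vanish at 0 gives the two linear bounds.\<close>

lemma primitive_inverse:
  fixes h :: "real \<Rightarrow> real"
  assumes h: "continuous_on UNIV h" "\<And>x. lo \<le> h x" "\<And>x. h x \<le> hi" and lo: "0 < lo"
  obtains G W where "\<And>x. (G has_real_derivative h x) (at x)" "\<And>x. \<bar>G x\<bar> \<le> hi * \<bar>x\<bar>"
    "\<And>x. W (G x) = x" "\<And>y. (W has_real_derivative 1 / h (W y)) (at y)" "\<And>y. \<bar>W y\<bar> \<le> \<bar>y\<bar> / lo"
proof -
  define G where "G = oint h 0"
  have dG: "(G has_real_derivative h x) (at x)" for x
    unfolding G_def by (rule oint_has_derivative'[OF h(1)])
  have G0: "G 0 = 0" by (simp add: G_def)
  have mvt: "\<exists>k\<ge>lo. k \<le> hi \<and> G x - G y = (x - y) * k" if "y < x" for x y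
    using MVT2[OF that, of G h] dG h by blast
  have mono: "lo * (x - y) \<le> G x - G y \<and> G x - G y \<le> hi * (x - y)" if le: "y \<le> x" for x y
  proof (cases "y < x")
    case True
    obtain k where "lo \<le> k" "k \<le> hi" "G x - G y = (x - y) * k" using mvt[OF True] by blast
    then show ?thesis using True by (simp add: mult.commute[of _ "x - y"] mult_left_mono)
  qed (use le in auto)
  have G_le: "\<bar>G x\<bar> \<le> hi * \<bar>x\<bar>" for x
  proof (cases "0 \<le> x")
    case True
    have "0 \<le> lo * x" using True lo by simp
    then show ?thesis using mono[OF True] True G0 by simp
  next
    case False
    have "lo * (0 - x) \<ge> 0" using False lo by (intro mult_nonneg_nonneg) auto
    then show ?thesis using mono[of x 0] False G0 by simp
  qed
  have expand: "lo * \<bar>x - y\<bar> \<le> \<bar>G x - G y\<bar>" for x y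
    using mono[of x y] mono[of y x] by (cases "x \<le> y") (auto simp: abs_minus_commute[of x y] abs_minus_commute[of "G x"])
  have surj: "\<exists>x. G x = y" for y
  proof -
    define R where "R = \<bar>y\<bar> / lo"
    have R: "0 \<le> R" "lo * R = \<bar>y\<bar>" using lo by (auto simp: R_def)
    have "y \<le> G R" "G (- R) \<le> y" using mono[of 0 R] mono[of "- R" 0] R G0 by auto
    moreover have "continuous_on {- R..R} G"
      using dG by (intro continuous_at_imp_continuous_on) (auto intro: DERIV_isCont)
    ultimately show ?thesis using IVT'[of G "- R" y R] R by auto
  qed
  define W where "W y = (SOME x. G x = y)" for y
  have GW: "G (W y) = y" for y unfolding W_def by (rule someI_ex[OF surj])
  have WG: "W (G x) = x" for x using expand[of "W (G x)" x] GW[of "G x"] lo by (simp add: zero_le_mult_iff mult_le_0_iff)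
  have W_lip: "\<bar>W y - W z\<bar> \<le> 1 / lo * \<bar>y - z\<bar>" for y z
    using expand[of "W y" "W z"] lo by (simp add: GW field_simps)
  have W_cont: "isCont W y" for y
  proof -
    have "continuous_on UNIV W"
      by (rule lipschitz_on_continuous_on[of "1 / lo"], rule lipschitz_onI) (use W_lip lo in \<open>auto simp: dist_real_def\<close>)
    then show ?thesis by (simp add: continuous_on_eq_continuous_at)
  qed
  have dW: "(W has_real_derivative 1 / h (W y)) (at y)" for y
    using DERIV_inverse_function[OF dG, of W y "y - 1" "y + 1"] h(2)[of "W y"] lo GW W_cont
    by (auto simp: inverse_eq_divide)
  have "\<bar>W y\<bar> \<le> \<bar>y\<bar> / lo" for y
    using W_lip[of y 0] WG[of 0] G0 by simp
  then show thesis using that[OF dG G_le WG dW] by blast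
qed

lemma Linf_norm_le:
  assumes "continuous_on UNIV h" "\<And>x. \<bar>h x\<bar> \<le> B"
  shows "Linf_norm h \<le> ereal B"
  unfolding Linf_norm_def
proof (rule esssup_I)
  have "h \<in> borel_measurable borel" by (rule borel_measurable_continuous_onI[OF assms(1)])
  then show "(\<lambda>x. ereal \<bar>h x\<bar>) \<in> borel_measurable lborel" by measurable
qed (use assms(2) in auto)

lemma continuous_on_slice:
  fixes v :: "'a::topological_space \<Rightarrow> 'b::topological_space \<Rightarrow> 'c::topological_space"
  assumes "continuous_on (S \<times> UNIV) (\<lambda>(t, x). v t x)" "t \<in> S"
  shows "continuous_on UNIV (v t)"
proof -
  have "continuous_on UNIV (\<lambda>x::'b. (t, x))" by (intro continuous_intros)
  then show ?thesis using continuous_on_compose2[OF assms(1), of UNIV "\<lambda>x. (t, x)"] assms(2) by auto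
qed

text \<open>A uniform pointwise bound controls the essential suprema, and a closed interval
  containing the values of \<open>ux\<close> also contains their closure.\<close>

lemma solvable_uptoI:
  assumes C2: "C2_on_strip T u ut ux utt utx uxx"
    and eq: "\<And>t x. t \<in> {0..<T} \<Longrightarrow> utt t x = (c (ux t x))\<^sup>2 * uxx t x"
    and ini: "\<And>x. u 0 x = f x" "\<And>x. ut 0 x = g x"
    and B: "\<And>v t x. v \<in> {u, ut, ux, utt, utx, uxx} \<Longrightarrow> t \<in> {0..<T} \<Longrightarrow> \<bar>v t x\<bar> \<le> B"
    and U: "\<And>t x. t \<in> {0..<T} \<Longrightarrow> \<bar>ux t x\<bar> \<le> \<rho>" "{- \<rho>..\<rho>} \<subseteq> U"
  shows "solvable_upto U c f g T"
  unfolding solvable_upto_def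
proof (intro exI conjI)
  have n: "Linf_norm (v t) \<le> ereal B" if "v \<in> {u, ut, ux, utt, utx, uxx}" "t \<in> {0..<T}" for v t
  proof (rule Linf_norm_le)
    have "continuous_on ({0..<T} \<times> UNIV) (\<lambda>(t, x). v t x)"
      using C2 that(1) unfolding C2_on_strip_def by blast
    then show "continuous_on UNIV (v t)" by (rule continuous_on_slice) (rule that(2))
  qed (rule B[OF that])
  have "(SUP t\<in>{0..<T}. Linf_norm (u t) + Linf_norm (ut t) + Linf_norm (ux t)
      + Linf_norm (utt t) + Linf_norm (utx t) + Linf_norm (uxx t))
    \<le> ereal B + ereal B + ereal B + ereal B + ereal B + ereal B"
    by (intro SUP_least add_mono n) auto
  also have "\<dots> < \<infinity>" by simp
  finally show "(SUP t\<in>{0..<T}. Linf_norm (u t) + Linf_norm (ut t) + Linf_norm (ux t)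
      + Linf_norm (utt t) + Linf_norm (utx t) + Linf_norm (uxx t)) < \<infinity>" .
  have "(\<lambda>(t, x). ux t x) ` ({0..<T} \<times> UNIV) \<subseteq> {- \<rho>..\<rho>}"
    using U(1) by (auto simp: abs_le_iff minus_le_iff)
  then have "closure ((\<lambda>(t, x). ux t x) ` ({0..<T} \<times> UNIV)) \<subseteq> {- \<rho>..\<rho>}"
    by (rule closure_minimal) simp
  then show "closure ((\<lambda>(t, x). ux t x) ` ({0..<T} \<times> UNIV)) \<subseteq> U" using U(2) by blast
qed (use C2 eq ini in auto)

text \<open>\<open>u_t\<close> and \<open>u_x\<close> are explicit functions of the Riemann
  invariants at the feet \<open>\<alpha>\<close> and \<open>\<beta>\<close>, and \<open>u\<close> is
  recovered by integrating \<open>u_t\<close> in time. Since |u_x| is at most \<open>3 * m\<close>,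
  where \<open>A\<close> bounds \<open>c'\<close>, the derivatives of the speed are at most
  \<open>2 * (A * m)\<close>, and \<open>A * m * L \<le> 1/800\<close> becomes the smallness
  condition of \<open>characteristic_coordinates\<close>.\<close>

lemma classical_solution:
  fixes c c' f f1 f2 g g1 :: "real \<Rightarrow> real"
  assumes f: "\<And>x. (f has_real_derivative f1 x) (at x)" "\<And>x. (f1 has_real_derivative f2 x) (at x)"
      "continuous_on UNIV f2"
    and g: "\<And>x. (g has_real_derivative g1 x) (at x)" "continuous_on UNIV g1"
    and m: "\<And>x. \<bar>f x\<bar> \<le> m" "\<And>x. \<bar>f1 x\<bar> \<le> m" "\<And>x. \<bar>f2 x\<bar> \<le> m"
      "\<And>x. \<bar>g x\<bar> \<le> m" "\<And>x. \<bar>g1 x\<bar> \<le> m"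
    and c: "\<And>\<theta>. \<bar>\<theta>\<bar> < r \<Longrightarrow> (c has_real_derivative c' \<theta>) (at \<theta>)" "continuous_on {-r<..<r} c'"
      "\<And>\<theta>. \<bar>\<theta>\<bar> < r \<Longrightarrow> \<bar>c \<theta> - 1\<bar> \<le> 1/100"
    and r: "3 * m < r" "{-r<..<r} \<subseteq> U"
    and A: "\<And>\<theta>. \<bar>\<theta>\<bar> \<le> 3 * m \<Longrightarrow> \<bar>c' \<theta>\<bar> \<le> A"
    and L: "0 < L" "A * m * L \<le> 1/800"
  shows "solvable_upto U c f g (L / 4)"
proof -

  \<comment> \<open>Clamped speed, its primitive, and the Riemann invariants\<close>
  define \<rho> where "\<rho> = 3 * m"
  have m0: "0 \<le> m" using m(1)[of 0] by linarith
  have A0: "0 \<le> A" using A[of 0] m0 by simp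
  \<comment> \<open>Clamping the argument gives a positive speed on the whole line, whose primitive
    can be inverted globally. The values of \<open>u_x\<close> stay in the range where it agrees
    with \<open>c\<close>, by \<open>V_bound\<close> below.\<close>
  define h where "h \<theta> = c (max (- \<rho>) (min \<rho> \<theta>))" for \<theta>
  have clamp: "\<bar>max (- \<rho>) (min \<rho> \<theta>)\<bar> < r" for \<theta> using r m0 by (auto simp: \<rho>_def)
  have h_bounds: "99/100 \<le> h \<theta>" "h \<theta> \<le> 101/100" for \<theta>
    using c(3)[OF clamp[of \<theta>]] unfolding h_def by linarith+
  have c_cont: "continuous_on {-r<..<r} c"
    by (intro continuous_at_imp_continuous_on) (auto intro!: DERIV_isCont[OF c(1)])
  have h_cont: "continuous_on UNIV h"
    unfolding h_def by (rule continuous_on_compose2[OF c_cont])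
      (use clamp in \<open>auto intro!: continuous_intros simp: abs_less_iff minus_less_iff\<close>)
  have h_eq: "h \<theta> = c \<theta>" if "\<bar>\<theta>\<bar> \<le> \<rho>" for \<theta>
  proof -
    have "max (- \<rho>) (min \<rho> \<theta>) = \<theta>" using that by linarith
    then show ?thesis by (simp add: h_def)
  qed
  obtain G W where G: "\<And>x. (G has_real_derivative h x) (at x)" "\<And>x. \<bar>G x\<bar> \<le> 101/100 * \<bar>x\<bar>"
    and W: "\<And>x. W (G x) = x" "\<And>y. (W has_real_derivative 1 / h (W y)) (at y)" "\<And>y. \<bar>W y\<bar> \<le> \<bar>y\<bar> / (99/100)"
    using primitive_inverse[OF h_cont h_bounds] by auto
  \<comment> \<open>Initial values of \<open>u_t + G(u_x)\<close> and \<open>u_t - G(u_x)\<close>,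
    followed by their derivatives.\<close>
  define R where "R a = g a + G (f1 a)" for a
  define S where "S a = g a - G (f1 a)" for a
  define R1 where "R1 a = g1 a + h (f1 a) * f2 a" for a
  define S1 where "S1 a = g1 a - h (f1 a) * f2 a" for a
  have RS: "(R has_real_derivative R1 a) (at a)" "(S has_real_derivative S1 a) (at a)" for a
    unfolding R_def S_def R1_def S1_def
    using DERIV_chain2[OF G(1) f(2)] g(1) by (auto intro!: DERIV_add DERIV_diff)
  have RS_bound: "\<bar>R a\<bar> \<le> 201/100 * m" "\<bar>S a\<bar> \<le> 201/100 * m" for a
    using G(2)[of "f1 a"] m(2)[of a] m(4)[of a] unfolding R_def S_def by linarith+
  have RS1_bound: "\<bar>R1 a\<bar> \<le> 201/100 * m" "\<bar>S1 a\<bar> \<le> 201/100 * m" for a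
  proof -
    have "\<bar>h (f1 a) * f2 a\<bar> \<le> 101/100 * m"
      unfolding abs_mult using h_bounds[of "f1 a"] m(3)[of a] by (intro mult_mono) auto
    then show "\<bar>R1 a\<bar> \<le> 201/100 * m" "\<bar>S1 a\<bar> \<le> 201/100 * m"
      using m(5)[of a] unfolding R1_def S1_def by linarith+
  qed
  have f1_cont: "continuous_on UNIV f1" using f(2) by (auto intro!: continuous_at_imp_continuous_on intro: DERIV_isCont)
  have RS_cont: "continuous_on UNIV R" "continuous_on UNIV S"
    using RS by (auto intro!: continuous_at_imp_continuous_on intro: DERIV_isCont)
  have RS1_cont: "continuous_on UNIV R1" "continuous_on UNIV S1"
    unfolding R1_def S1_def
    by (intro continuous_intros g f continuous_on_compose2[OF h_cont f1_cont] subset_UNIV)+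
  \<comment> \<open>\<open>(R a - S b) / 2\<close> is the value of \<open>G(u_x)\<close> where the
    characteristics from \<open>a\<close> and \<open>b\<close> meet, and \<open>W\<close> inverts
    \<open>G\<close>; so \<open>V\<close> is \<open>u_x\<close> there. The bound by
    \<open>3 * m\<close> holds because \<open>201/100 / (99/100)\<close> is below 3.\<close>
  define V where "V a b = W ((R a - S b) / 2)" for a b
  have V_bound: "\<bar>V a b\<bar> \<le> \<rho>" for a b
  proof -
    have "\<bar>(R a - S b) / 2\<bar> \<le> 201/100 * m"
      using abs_triangle_ineq4[of "R a" "S b"] RS_bound(1)[of a] RS_bound(2)[of b] by simp
    moreover have "\<bar>W y\<bar> \<le> 3 * m" if "\<bar>y\<bar> \<le> 201/100 * m" for y
      using W(3)[of y] that m0 by simp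
    ultimately show ?thesis unfolding V_def \<rho>_def by blast
  qed
  have V_r: "\<bar>V a b\<bar> < r" for a b using V_bound[of a b] r(1) by (simp add: \<rho>_def)
  define l where "l a b = c (V a b)" for a b
  have hV: "h (V a b) = l a b" for a b by (simp add: h_eq V_bound l_def)
  have l_near: "\<bar>l a b - 1\<bar> \<le> 1/100" for a b unfolding l_def by (rule c(3)[OF V_r])
  have l_low: "99/100 \<le> l a b" for a b using l_near[of a b] by linarith
  then have l_nz: "l a b \<noteq> 0" for a b by (metis less_numeral_extra(3) not_le zero_less_divide_iff zero_less_numeral)

  \<comment> \<open>Derivatives of the wave speed in the feet \<open>a\<close> and
    \<open>b\<close>\<close>
  define Va where "Va a b = R1 a / (2 * l a b)" for a b
  define Vb where "Vb a b = - S1 b / (2 * l a b)" for a b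
  have dVa: "((\<lambda>a. V a b) has_real_derivative Va a b) (at a)" for a b
  proof -
    have "((\<lambda>a. W ((R a - S b) / 2)) has_real_derivative (1 / h (W ((R a - S b) / 2))) * ((R1 a - 0) / 2)) (at a)"
      by (rule DERIV_chain2[OF W(2)]) (intro DERIV_cdivide DERIV_diff RS DERIV_const)
    then show ?thesis by (simp add: hV Va_def mult.commute flip: V_def)
  qed
  have dVb: "((\<lambda>b. V a b) has_real_derivative Vb a b) (at b)" for a b
  proof -
    have "((\<lambda>b. W ((R a - S b) / 2)) has_real_derivative (1 / h (W ((R a - S b) / 2))) * ((0 - S1 b) / 2)) (at b)"
      by (rule DERIV_chain2[OF W(2)]) (intro DERIV_cdivide DERIV_diff RS DERIV_const)
    then show ?thesis by (simp add: hV Vb_def mult.commute flip: V_def)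
  qed
  define la where "la a b = c' (V a b) * Va a b" for a b
  define lb where "lb a b = c' (V a b) * Vb a b" for a b
  have dl: "((\<lambda>a. l a b) has_real_derivative la a b) (at a)" "((\<lambda>b. l a b) has_real_derivative lb a b) (at b)" for a b
    unfolding l_def la_def lb_def by (rule DERIV_chain2[where f=c], rule c(1)[OF V_r], rule dVa dVb)+
  have comp: "continuous_on X (\<lambda>x. k (p x))" if "continuous_on UNIV k" "continuous_on X p"
    for k :: "real \<Rightarrow> real" and X :: "(real \<times> real) set" and p
    using continuous_on_compose2[OF that] by auto
  have W_cont: "continuous_on UNIV W" using W(2) by (auto intro!: continuous_at_imp_continuous_on intro: DERIV_isCont)
  have V_cont: "cont2 V"
    unfolding V_def case_prod_unfold
    by (intro comp[OF W_cont] continuous_intros comp[OF RS_cont(1)] comp[OF RS_cont(2)]) auto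
  have V_mem: "V a b \<in> {-r<..<r}" for a b using V_r[of a b] by auto
  have l_cont: "cont2 l"
    unfolding l_def case_prod_unfold
    by (rule continuous_on_compose2[OF c_cont cont2_compose[OF V_cont]]) (use V_mem in \<open>auto intro!: continuous_intros\<close>)
  have c'V_cont: "cont2 (\<lambda>a b. c' (V a b))"
    unfolding case_prod_unfold
    by (rule continuous_on_compose2[OF c(2) cont2_compose[OF V_cont]]) (use V_mem in \<open>auto intro!: continuous_intros\<close>)
  have VaVb_cont: "cont2 Va" "cont2 Vb"
    unfolding Va_def Vb_def case_prod_unfold
    by (intro continuous_intros comp[OF RS1_cont(1)] comp[OF RS1_cont(2)] cont2_compose[OF l_cont]; simp add: l_nz)+
  have lab_cont: "cont2 la" "cont2 lb"
    unfolding la_def lb_def case_prod_unfold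
    by (intro continuous_intros cont2_compose[OF c'V_cont] cont2_compose[OF VaVb_cont(1)] cont2_compose[OF VaVb_cont(2)])+
  have half: "\<bar>q / (2 * l a b)\<bar> \<le> 2 * m" if "\<bar>q\<bar> \<le> 201/100 * m" for q a b
  proof -
    have "201/100 * m \<le> 2 * m * (2 * l a b)" using l_low[of a b] m0 mult_left_mono[of "99/100" "l a b" m] by simp
    then show ?thesis using that l_low[of a b] by (simp add: abs_mult divide_le_eq)
  qed
  have lab_bound: "\<bar>la a b\<bar> \<le> 2 * (A * m)" "\<bar>lb a b\<bar> \<le> 2 * (A * m)" for a b
  proof -
    have "\<bar>c' (V a b)\<bar> \<le> A" using V_bound[of a b] by (intro A) (simp add: \<rho>_def)
    then have *: "\<bar>c' (V a b) * q\<bar> \<le> A * (2 * m)" if "\<bar>q\<bar> \<le> 2 * m" for q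
      unfolding abs_mult using that A0 by (intro mult_mono) auto
    have "\<bar>Va a b\<bar> \<le> 2 * m" "\<bar>Vb a b\<bar> \<le> 2 * m"
      unfolding Va_def Vb_def by (rule half; use RS1_bound in simp)+
    from *[OF this(1)] *[OF this(2)] show "\<bar>la a b\<bar> \<le> 2 * (A * m)" "\<bar>lb a b\<bar> \<le> 2 * (A * m)"
      by (simp_all add: la_def lb_def mult_ac)
  qed

  \<comment> \<open>Passage from characteristic coordinates to \<open>t\<close> and
    \<open>x\<close>\<close>
  have L': "2 * (A * m) * L \<le> 1/400" using L(2) by simp
  note cc = characteristic_coordinates[where l=l and la=la and lb=lb and L=L and \<kappa>="2 * (A * m)",
      OF dl(1) lab_cont(1) dl(2) lab_cont(2) l_cont l_near lab_bound L(1) L']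
  obtain \<alpha> \<beta> P Q where PQ_cont: "cont2 P" "cont2 Q"
    and PQ: "\<And>a b. \<bar>a - b\<bar> \<le> L \<Longrightarrow> \<bar>P a b - 1/2\<bar> \<le> 1/32" "\<And>a b. \<bar>a - b\<bar> \<le> L \<Longrightarrow> \<bar>Q a b - 1/2\<bar> \<le> 1/32"
    and strip: "\<And>s y. \<bar>s\<bar> < L / 4 \<Longrightarrow> \<bar>\<alpha> (s, y) - \<beta> (s, y)\<bar> \<le> L"
    and \<alpha>0: "\<And>y. \<alpha> (0, y) = y" and \<beta>0: "\<And>y. \<beta> (0, y) = y"
    and grad: "\<And>s y a b. \<bar>s\<bar> < L / 4 \<Longrightarrow> a = \<alpha> (s, y) \<Longrightarrow> b = \<beta> (s, y) \<Longrightarrow>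
       has_grad \<alpha> (1 / (2 * P a b)) (1 / (2 * l a b * P a b)) (s, y) \<and>
       has_grad \<beta> (- 1 / (2 * Q a b)) (1 / (2 * l a b * Q a b)) (s, y)"
    by (rule cc) (rule that; assumption)
  \<comment> \<open>A strip that is open and symmetric in time, so that two-sided derivatives exist
    at \<open>t = 0\<close> too; the one-sided ones follow by restriction.\<close>
  define D where "D = {- (L/4)<..<L/4} \<times> (UNIV :: real set)"
  define p where "p z = P (\<alpha> z) (\<beta> z)" for z
  define q where "q z = Q (\<alpha> z) (\<beta> z)" for z
  define k where "k z = l (\<alpha> z) (\<beta> z)" for z
  define v where "v z = V (\<alpha> z) (\<beta> z)" for z
  define w where "w z = (R (\<alpha> z) + S (\<beta> z)) / 2" for z
  \<comment> \<open>The chain rule through \<open>\<alpha>\<close> and \<open>\<beta>\<close> gives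
    these derivatives of \<open>v = u_x\<close> and \<open>w = u_t\<close>. The one function
    \<open>wx\<close> is both \<open>w_x\<close> and \<open>v_t\<close>, the compatibility needed
    for a potential \<open>u\<close>, and \<open>wt z = (k z)^2 * vx z\<close> is the wave
    equation.\<close>
  define vx where "vx z = (R1 (\<alpha> z) / p z - S1 (\<beta> z) / q z) / (4 * (k z)\<^sup>2)" for z
  define wx where "wx z = (R1 (\<alpha> z) / p z + S1 (\<beta> z) / q z) / (4 * k z)" for z
  define wt where "wt z = (R1 (\<alpha> z) / p z - S1 (\<beta> z) / q z) / 4" for z
  have D_fst: "\<bar>fst z\<bar> < L / 4" if "z \<in> D" for z
    using that by (auto simp: D_def)
  have st: "\<bar>\<alpha> z - \<beta> z\<bar> \<le> L" if "z \<in> D" for z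
    using strip[OF D_fst[OF that], of "snd z"] by simp
  have pq: "15/32 \<le> p z" "15/32 \<le> q z" if "z \<in> D" for z
    using PQ(1)[OF st[OF that]] PQ(2)[OF st[OF that]] unfolding p_def q_def by linarith+
  have k: "99/100 \<le> k z" for z unfolding k_def by (rule l_low)
  have nz: "p z \<noteq> 0" "q z \<noteq> 0" "k z \<noteq> 0" if "z \<in> D" for z
    using pq[OF that] k[of z] by linarith+
  have grads: "has_grad \<alpha> (1 / (2 * p z)) (1 / (2 * k z * p z)) z" "has_grad \<beta> (- 1 / (2 * q z)) (1 / (2 * k z * q z)) z"
    if "z \<in> D" for z
    using grad[OF D_fst[OF that], of "\<alpha> z" "snd z" "\<beta> z"] unfolding p_def q_def k_def prod.collapse by blast+
  have ab_cont: "continuous_on D \<alpha>" "continuous_on D \<beta>"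
    by (rule continuous_on_of_has_grad[OF grads(1)] continuous_on_of_has_grad[OF grads(2)]; assumption)+

  \<comment> \<open>Gradients of \<open>u_t\<close> and \<open>u_x\<close>\<close>
  have dw: "has_grad w (wt z) (wx z) z" if z: "z \<in> D" for z
  proof -
    have "has_grad (\<lambda>z. R (\<alpha> z)) (R1 (\<alpha> z) * (1 / (2 * p z))) (R1 (\<alpha> z) * (1 / (2 * k z * p z))) z"
      "has_grad (\<lambda>z. S (\<beta> z)) (S1 (\<beta> z) * (- 1 / (2 * q z))) (S1 (\<beta> z) * (1 / (2 * k z * q z))) z"
      by (rule has_grad_chain[OF RS(1) grads(1)[OF z]] has_grad_chain[OF RS(2) grads(2)[OF z]])+
    from has_grad_midpoint[OF this] have "has_grad w
      ((R1 (\<alpha> z) * (1 / (2 * p z)) + S1 (\<beta> z) * (- 1 / (2 * q z))) / 2)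
      ((R1 (\<alpha> z) * (1 / (2 * k z * p z)) + S1 (\<beta> z) * (1 / (2 * k z * q z))) / 2) z"
      unfolding w_def .
    moreover have "(R1 (\<alpha> z) * (1 / (2 * p z)) + S1 (\<beta> z) * (- 1 / (2 * q z))) / 2 = wt z"
      unfolding wt_def using nz[OF z] by (simp add: field_simps)
    moreover have "(R1 (\<alpha> z) * (1 / (2 * k z * p z)) + S1 (\<beta> z) * (1 / (2 * k z * q z))) / 2 = wx z"
      unfolding wx_def using nz[OF z] by (simp add: field_simps)
    ultimately show ?thesis by simp
  qed
  have dv: "has_grad v (wx z) (vx z) z" if z: "z \<in> D" for z
  proof -
    have gV: "has_grad (\<lambda>z. V (fst z) (snd z)) (Va (fst z) (snd z)) (Vb (fst z) (snd z)) z" for z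
      by (rule has_grad_of_partials[OF dVa dVb VaVb_cont(2)])
    have "has_grad (\<lambda>z. V (fst (\<alpha> z, \<beta> z)) (snd (\<alpha> z, \<beta> z)))
      (Va (\<alpha> z) (\<beta> z) * (1 / (2 * p z)) + Vb (\<alpha> z) (\<beta> z) * (- 1 / (2 * q z)))
      (Va (\<alpha> z) (\<beta> z) * (1 / (2 * k z * p z)) + Vb (\<alpha> z) (\<beta> z) * (1 / (2 * k z * q z))) z"
      using has_grad_compose[OF gV[of "(\<alpha> z, \<beta> z)"] grads(1)[OF z] grads(2)[OF z]] by simp
    moreover have "Va (\<alpha> z) (\<beta> z) * (1 / (2 * p z)) + Vb (\<alpha> z) (\<beta> z) * (- 1 / (2 * q z)) = wx z"
      unfolding Va_def Vb_def wx_def k_def[symmetric] using nz[OF z] by (simp add: field_simps)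
    moreover have "Va (\<alpha> z) (\<beta> z) * (1 / (2 * k z * p z)) + Vb (\<alpha> z) (\<beta> z) * (1 / (2 * k z * q z)) = vx z"
      unfolding Va_def Vb_def vx_def k_def[symmetric] using nz[OF z] by (simp add: field_simps power2_eq_square)
    ultimately show ?thesis unfolding v_def by simp
  qed
  have comp': "continuous_on D (\<lambda>z. \<kappa> (\<alpha> z))" "continuous_on D (\<lambda>z. \<kappa> (\<beta> z))"
    if "continuous_on UNIV \<kappa>" for \<kappa> :: "real \<Rightarrow> real"
    using continuous_on_compose2[OF that ab_cont(1)] continuous_on_compose2[OF that ab_cont(2)] by auto
  have pqk_cont: "continuous_on D p" "continuous_on D q" "continuous_on D k"
    unfolding p_def q_def k_def by (intro cont2_compose[OF _ ab_cont] PQ_cont l_cont)+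
  have vw_cont: "continuous_on D v" "continuous_on D w"
    by (rule continuous_on_of_has_grad[OF dv] continuous_on_of_has_grad[OF dw]; assumption)+
  have d_cont: "continuous_on D vx" "continuous_on D wx" "continuous_on D wt"
    unfolding vx_def wx_def wt_def
    by (intro continuous_intros comp' RS1_cont pqk_cont; simp add: nz)+

  \<comment> \<open>Recovering \<open>u\<close>\<close>
  define I where "I = {- (L/4)<..<L/4}"
  have I: "convex I" "open I" "0 \<in> I" and D_I: "D = I \<times> UNIV" using L(1) by (auto simp: I_def D_def)
  have slice: "continuous_on I (\<lambda>s. \<kappa> (s, x))" if "continuous_on D \<kappa>" for \<kappa> :: "real \<times> real \<Rightarrow> real" and x
    by (rule continuous_on_compose2[OF that]) (auto simp: D_I intro!: continuous_intros)
  \<comment> \<open>\<open>u_t = w\<close> is immediate. Differentiating under the integral and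
    using \<open>w_x = v_t\<close> gives \<open>u_x = f1 + v(t, x) - v(0, x)\<close>, which is
    \<open>v(t, x)\<close> because \<open>v(0, x) = f1 x\<close>.\<close>
  define u where "u t x = f x + oint (\<lambda>s. w (s, x)) 0 t" for t x
  have v0: "v (0, x) = f1 x" and w0: "w (0, x) = g x" for x
    by (simp_all add: v_def w_def V_def R_def S_def \<alpha>0 \<beta>0 W(1))
  have ut: "((\<lambda>s. u s x) has_real_derivative w (t, x)) (at t)" if "t \<in> I" for t x
  proof -
    have "((\<lambda>t. f x + oint (\<lambda>s. w (s, x)) 0 t) has_real_derivative 0 + w (t, x)) (at t)"
      by (intro DERIV_add DERIV_const oint_has_derivative[where S=I] I that slice vw_cont)
    then show ?thesis by (simp add: u_def)
  qed
  have ux: "((\<lambda>y. u t y) has_real_derivative v (t, x)) (at x)" if "t \<in> I" for t x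
  proof -
    have swap: "continuous_on (UNIV \<times> I) (\<lambda>(x, s). wx (s, x))"
      unfolding case_prod_unfold
      by (rule continuous_on_compose2[OF d_cont(2)]) (auto simp: D_I intro!: continuous_intros)
    have "((\<lambda>y. u t y) has_real_derivative f1 x + oint (\<lambda>s. wx (s, x)) 0 t) (at x)"
      unfolding u_def
      by (intro DERIV_add f oint_leibniz[where X=UNIV and S=I] I that slice vw_cont swap
          has_grad_partials(2)[OF dw]) (auto simp: D_I)
    moreover have "oint (\<lambda>s. wx (s, x)) 0 t = v (t, x) - v (0, x)"
      by (rule oint_eq_diff[where S=I and F="\<lambda>s. v (s, x)"])
        (use I that has_grad_partials(1)[OF dv] in \<open>auto simp: D_I intro: has_field_derivative_at_within\<close>)
    ultimately show ?thesis by (simp add: v0)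
  qed
  have u_cont: "continuous_on D (\<lambda>z. u (fst z) (snd z))"
  proof -
    have "continuous_on D (\<lambda>z. oint (\<lambda>s. w (s, snd z)) 0 (fst z))"
    proof (rule continuous_on_oint[where S=I])
      show "continuous_on (D \<times> I) (\<lambda>(z, s). w (s, snd z))"
        unfolding case_prod_unfold
        by (rule continuous_on_compose2[OF vw_cont(2)]) (auto simp: D_I intro!: continuous_intros)
    qed (use I in \<open>auto simp: D_I intro!: continuous_intros\<close>)
    moreover have "continuous_on UNIV f"
      using f(1) by (auto intro!: continuous_at_imp_continuous_on intro: DERIV_isCont)
    ultimately show ?thesis
      unfolding u_def by (intro continuous_intros continuous_on_compose2[of UNIV f D snd]) auto
  qed
  have sub: "{0..<L/4} \<subseteq> I" using L(1) by (auto simp: I_def)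

  \<comment> \<open>Uniform bounds\<close>
  have w_bound: "\<bar>w z\<bar> \<le> 3 * m" for z
    using abs_triangle_ineq[of "R (\<alpha> z)" "S (\<beta> z)"] RS_bound(1)[of "\<alpha> z"] RS_bound(2)[of "\<beta> z"] m0
    by (simp add: w_def)
  have quot: "\<bar>x / y\<bar> \<le> 5 * m" if "\<bar>x\<bar> \<le> 201/100 * m" "15/32 \<le> y" for x y
  proof -
    have "201/100 * m \<le> 5 * m * y" using that(2) m0 mult_left_mono[of "15/32" y m] by simp
    then show ?thesis using that by (simp add: abs_mult divide_le_eq)
  qed
  have bounds: "\<bar>wt z\<bar> \<le> 10 * m" "\<bar>wx z\<bar> \<le> 10 * m" "\<bar>vx z\<bar> \<le> 10 * m" if z: "z \<in> D" for z
  proof -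
    have q1: "\<bar>R1 (\<alpha> z) / p z\<bar> \<le> 5 * m" "\<bar>S1 (\<beta> z) / q z\<bar> \<le> 5 * m"
      using quot[OF RS1_bound(1) pq(1)[OF z]] quot[OF RS1_bound(2) pq(2)[OF z]] by auto
    have n: "\<bar>R1 (\<alpha> z) / p z - S1 (\<beta> z) / q z\<bar> \<le> 10 * m" "\<bar>R1 (\<alpha> z) / p z + S1 (\<beta> z) / q z\<bar> \<le> 10 * m"
      using q1 by linarith+
    have sm: "\<bar>x / y\<bar> \<le> 10 * m" if "\<bar>x\<bar> \<le> 10 * m" "1 \<le> y" for x y
    proof -
      have "10 * m * 1 \<le> 10 * m * y" using that(2) m0 by (intro mult_left_mono) auto
      then show ?thesis using that by (simp add: divide_le_eq)
    qed
    have "(99/100)\<^sup>2 \<le> (k z)\<^sup>2" using k[of z] by (intro power_mono) auto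
    then have k1: "1 \<le> 4 * (k z)\<^sup>2" "1 \<le> 4 * k z" using k[of z] by (auto simp: power2_eq_square)
    show "\<bar>wt z\<bar> \<le> 10 * m" "\<bar>wx z\<bar> \<le> 10 * m" "\<bar>vx z\<bar> \<le> 10 * m"
      unfolding wt_def wx_def vx_def
      by (rule sm[OF n(1) one_le_numeral] sm[OF n(2) k1(2)] sm[OF n(1) k1(1)])+
  qed
  show ?thesis
  \<comment> \<open>\<open>10 * m\<close> bounds all derivatives, while \<open>u\<close> is at most
    \<open>m\<close> plus the time integral of \<open>w\<close>, which \<open>3 * m * L\<close>
    bounds.\<close>
  proof (rule solvable_uptoI[where \<rho>=\<rho> and B="10 * m + 3 * m * L" and u=u
        and ut="\<lambda>t x. w (t, x)" and ux="\<lambda>t x. v (t, x)" and utt="\<lambda>t x. wt (t, x)"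
        and utx="\<lambda>t x. wx (t, x)" and uxx="\<lambda>t x. vx (t, x)"])
    have D_sub: "{0..<L/4} \<times> UNIV \<subseteq> D" using sub by (auto simp: D_I)
    show "C2_on_strip (L/4) u (\<lambda>t x. w (t, x)) (\<lambda>t x. v (t, x)) (\<lambda>t x. wt (t, x)) (\<lambda>t x. wx (t, x)) (\<lambda>t x. vx (t, x))"
      unfolding C2_on_strip_def
    proof (intro conjI ballI allI)
      fix t x assume "t \<in> {0..<L/4}"
      then have t: "t \<in> I" and z: "(t, x) \<in> D" using sub D_sub by auto
      note ws = has_field_derivative_at_within
      show "((\<lambda>s. u s x) has_real_derivative w (t, x)) (at t within {0..<L/4})" by (rule ws[OF ut[OF t]])
      show "(u t has_real_derivative v (t, x)) (at x)" by (rule ux[OF t])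
      show "((\<lambda>s. w (s, x)) has_real_derivative wt (t, x)) (at t within {0..<L/4})"
        "((\<lambda>s. v (s, x)) has_real_derivative wx (t, x)) (at t within {0..<L/4})"
        by (rule ws[OF has_grad_partials(1)[OF dw[OF z]]] ws[OF has_grad_partials(1)[OF dv[OF z]]])+
      show "((\<lambda>y. w (t, y)) has_real_derivative wx (t, x)) (at x)"
        "((\<lambda>y. v (t, y)) has_real_derivative vx (t, x)) (at x)"
        by (rule has_grad_partials(2)[OF dw[OF z]] has_grad_partials(2)[OF dv[OF z]])+
    next
      fix \<kappa> assume "\<kappa> \<in> {u, \<lambda>t x. w (t, x), \<lambda>t x. v (t, x), \<lambda>t x. wt (t, x), \<lambda>t x. wx (t, x), \<lambda>t x. vx (t, x)}"
      then have "continuous_on D (\<lambda>(t, x). \<kappa> t x)"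
        using u_cont vw_cont d_cont by (auto simp: case_prod_unfold)
      then show "continuous_on ({0..<L/4} \<times> UNIV) (\<lambda>(t, x). \<kappa> t x)"
        by (rule continuous_on_subset[OF _ D_sub])
    qed
    show "wt (t, x) = (c (v (t, x)))\<^sup>2 * vx (t, x)" if "t \<in> {0..<L/4}" for t x
    proof -
      have "(t, x) \<in> D" using that D_sub by auto
      moreover have "c (v (t, x)) = k (t, x)" by (simp add: v_def k_def l_def)
      ultimately show ?thesis using nz(3) by (simp add: wt_def vx_def)
    qed
    show "u 0 x = f x" "w (0, x) = g x" for x by (simp_all add: u_def w0)
    have v_bound: "\<bar>v z\<bar> \<le> \<rho>" for z unfolding v_def by (rule V_bound)
    then show "\<bar>v (t, x)\<bar> \<le> \<rho>" for t x .
    show "{- \<rho>..\<rho>} \<subseteq> U" using r by (auto simp: \<rho>_def)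
    fix \<kappa> t x
    assume \<kappa>: "\<kappa> \<in> {u, \<lambda>t x. w (t, x), \<lambda>t x. v (t, x), \<lambda>t x. wt (t, x), \<lambda>t x. wx (t, x), \<lambda>t x. vx (t, x)}"
      and t: "t \<in> {0..<L/4}"
    have z: "(t, x) \<in> D" and tI: "t \<in> I" using t D_sub sub by auto
    have mL: "0 \<le> m * L" using m0 L(1) by simp
    have "\<bar>oint (\<lambda>s. w (s, x)) 0 t\<bar> \<le> 3 * m * \<bar>t - 0\<bar>"
      by (rule oint_bound[where S=I]) (use I tI w_bound in \<open>auto intro!: slice vw_cont\<close>)
    also have "\<dots> \<le> 3 * m * L" using t m0 by (intro mult_left_mono) auto
    finally have "\<bar>u t x\<bar> \<le> 10 * m + 3 * m * L" using m(1)[of x] m0 unfolding u_def by linarith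
    moreover have "\<bar>v (t, x)\<bar> \<le> 10 * m" using v_bound[of "(t, x)"] m0 by (simp add: \<rho>_def)
    moreover have "\<bar>w (t, x)\<bar> \<le> 10 * m" using w_bound[of "(t, x)"] m0 by simp
    ultimately show "\<bar>\<kappa> t x\<bar> \<le> 10 * m + 3 * m * L" using \<kappa> bounds[OF z] mL by auto
  qed
qed

subsection \<open>Lifespan\<close>

lemma lifespan_ge:
  assumes "0 < T" "solvable_upto U c f g T"
  shows "ereal T \<le> lifespan U c f g"
  unfolding lifespan_def using assms by (intro Sup_upper) auto

lemma times_differentiable_onD:
  assumes "times_differentiable_on m f U" "k < m" "x \<in> U"
  shows "((deriv ^^ k) f has_real_derivative (deriv ^^ Suc k) f x) (at x)"
  using assms by (simp add: times_differentiable_on_def DERIV_deriv_iff_real_differentiable)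

lemma C_boundedE:
  assumes "f \<in> C_bounded m"
  obtains B where "0 < B" "\<And>k x. k \<le> m \<Longrightarrow> \<bar>(deriv ^^ k) f x\<bar> \<le> B"
proof -
  have "bounded (\<Union>k\<in>{..m}. range ((deriv ^^ k) f))"
    using assms by (intro bounded_UN) (auto simp: C_bounded_def)
  then obtain B where "0 < B" "\<And>y. y \<in> (\<Union>k\<in>{..m}. range ((deriv ^^ k) f)) \<Longrightarrow> norm y \<le> B"
    unfolding bounded_pos by blast
  then show thesis by (intro that[of B]) auto
qed

text \<open>The two parts of the theorem are the cases \<open>q = p - 1\<close> and \<open>q = 1\<close>.\<close>

lemma lifespan_lower_bound:
  fixes c c' \<phi> \<psi> :: "real \<Rightarrow> real"
  assumes U: "open U" "0 \<in> U" and c0: "c 0 = 1"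
    and \<phi>: "\<phi> \<in> C_bounded 2" and \<psi>: "\<psi> \<in> C_bounded 1"
    and \<delta>: "0 < \<delta>" and c: "\<And>\<theta>. \<bar>\<theta>\<bar> < \<delta> \<Longrightarrow> (c has_real_derivative c' \<theta>) (at \<theta>)"
      "continuous_on {-\<delta><..<\<delta>} c'"
    and c': "\<And>b \<theta>. 0 < b \<Longrightarrow> b < \<delta> \<Longrightarrow> \<bar>\<theta>\<bar> \<le> b \<Longrightarrow> \<bar>c' \<theta>\<bar> \<le> K * b powr (q - 1)"
  shows "\<exists>\<epsilon>0>0. \<exists>C>0. \<forall>\<epsilon>. 0 < \<epsilon> \<and> \<epsilon> \<le> \<epsilon>0 \<longrightarrow>
    ereal (C * \<epsilon> powr (- q)) \<le> lifespan U c (\<lambda>x. \<epsilon> * \<phi> x) (\<lambda>x. \<epsilon> * \<psi> x)"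
proof -
  obtain M1 where M1: "0 < M1" "\<And>k x. k \<le> 2 \<Longrightarrow> \<bar>(deriv ^^ k) \<phi> x\<bar> \<le> M1" using C_boundedE[OF \<phi>] by blast
  obtain M2 where M2: "0 < M2" "\<And>k x. k \<le> 1 \<Longrightarrow> \<bar>(deriv ^^ k) \<psi> x\<bar> \<le> M2" using C_boundedE[OF \<psi>] by blast
  define M where "M = M1 + M2"
  have M: "0 < M" using M1(1) M2(1) by (simp add: M_def)
  define \<phi>1 \<phi>2 \<psi>1 where "\<phi>1 = deriv \<phi>" and "\<phi>2 = deriv \<phi>1" and "\<psi>1 = deriv \<psi>"
  have M_bounds: "\<bar>\<phi> x\<bar> \<le> M" "\<bar>\<phi>1 x\<bar> \<le> M" "\<bar>\<phi>2 x\<bar> \<le> M" "\<bar>\<psi> x\<bar> \<le> M" "\<bar>\<psi>1 x\<bar> \<le> M" for x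
    using M1(1) M2(1) M1(2)[of 0 x] M1(2)[of 1 x] M1(2)[of 2 x] M2(2)[of 0 x] M2(2)[of 1 x]
    by (simp_all add: M_def \<phi>1_def \<phi>2_def \<psi>1_def numeral_2_eq_2)
  have d: "(\<phi> has_real_derivative \<phi>1 x) (at x)" "(\<phi>1 has_real_derivative \<phi>2 x) (at x)"
    "(\<psi> has_real_derivative \<psi>1 x) (at x)" for x
    using times_differentiable_onD[of 2 \<phi> UNIV 0 x] times_differentiable_onD[of 2 \<phi> UNIV 1 x]
      times_differentiable_onD[of 1 \<psi> UNIV 0 x] \<phi> \<psi>
    by (simp_all add: C_bounded_def \<phi>1_def \<phi>2_def \<psi>1_def)
  have "continuous_on UNIV ((deriv ^^ 2) \<phi>)" "continuous_on UNIV ((deriv ^^ 1) \<psi>)"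
    using \<phi> \<psi> by (auto simp: C_bounded_def)
  then have cont: "continuous_on UNIV \<phi>2" "continuous_on UNIV \<psi>1"
    by (simp_all add: \<phi>1_def \<phi>2_def \<psi>1_def numeral_2_eq_2)
  obtain r1 where r1: "0 < r1" "ball 0 r1 \<subseteq> U" using U open_contains_ball by blast
  have "isCont c 0" using c(1)[of 0] \<delta> by (auto intro: DERIV_isCont)
  then obtain r2 where r2: "0 < r2" "\<And>\<theta>. \<bar>\<theta>\<bar> < r2 \<Longrightarrow> \<bar>c \<theta> - 1\<bar> \<le> 1/100"
    using continuous_at_eps_delta[of 0 c] c0 by (force simp: dist_real_def intro: less_imp_le dest: spec[of _ "1/100"])
  define r where "r = min \<delta> (min r1 r2)"
  have r: "0 < r" "r \<le> \<delta>" using \<delta> r1 r2 by (auto simp: r_def)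
  have rU: "{-r<..<r} \<subseteq> U"
    using r1(2) by (auto simp: r_def subset_iff dist_real_def abs_less_iff)
  have "0 \<le> K * (\<delta>/2) powr (q - 1)" using c'[of "\<delta>/2" 0] \<delta> by (simp add: order_trans[OF abs_ge_zero])
  then have K: "0 \<le> K" using \<delta> by (simp add: zero_le_mult_iff)
  \<comment> \<open>Chosen so that \<open>A * m = N * \<epsilon> powr q\<close> for
    \<open>m = \<epsilon> * M\<close>; taking \<open>K + 1\<close> for \<open>K\<close> keeps it
    positive even if \<open>K = 0\<close>.\<close>
  define N where "N = (K + 1) * (3 * M) powr (q - 1) * M"
  have N: "0 < N" using K M by (simp add: N_def)
  \<comment> \<open>Gives \<open>4 * m \<le> r\<close>, hence the strict inequality
    \<open>3 * m < r\<close>.\<close>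
  define \<epsilon>0 where "\<epsilon>0 = r / (4 * M)"
  \<comment> \<open>With \<open>L = 4 * (C * \<epsilon> powr (- q))\<close> the powers of
    \<open>\<epsilon>\<close> cancel in \<open>A * m * L\<close>, leaving \<open>4 * N * C\<close>,
    which is exactly the admissible 1/800.\<close>
  define C where "C = 1 / (3200 * N)"
  have "ereal (C * \<epsilon> powr (- q)) \<le> lifespan U c (\<lambda>x. \<epsilon> * \<phi> x) (\<lambda>x. \<epsilon> * \<psi> x)"
    if \<epsilon>: "0 < \<epsilon>" "\<epsilon> \<le> \<epsilon>0" for \<epsilon>
  proof -
    define m where "m = \<epsilon> * M"
    define L where "L = 4 * (C * \<epsilon> powr (- q))"
    define A where "A = (K + 1) * (3 * m) powr (q - 1)"
    have m: "0 < m" using \<epsilon> M by (simp add: m_def)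
    have "\<epsilon> * (4 * M) \<le> r" using \<epsilon>(2) M by (simp add: \<epsilon>0_def field_simps)
    then have m3: "3 * m < r" using m by (simp add: m_def)
    have L0: "0 < L" using N \<epsilon> by (simp add: L_def C_def)
    have "solvable_upto U c (\<lambda>x. \<epsilon> * \<phi> x) (\<lambda>x. \<epsilon> * \<psi> x) (L / 4)"
    proof (rule classical_solution[where m=m and r=r and A=A and c'=c'])
      have sc: "\<bar>\<epsilon> * y\<bar> \<le> m" if "\<bar>y\<bar> \<le> M" for y
        using that \<epsilon> by (simp add: m_def abs_mult)
      show "\<bar>\<epsilon> * \<phi> x\<bar> \<le> m" "\<bar>\<epsilon> * \<phi>1 x\<bar> \<le> m" "\<bar>\<epsilon> * \<phi>2 x\<bar> \<le> m" "\<bar>\<epsilon> * \<psi> x\<bar> \<le> m" "\<bar>\<epsilon> * \<psi>1 x\<bar> \<le> m" for x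
        by (rule sc M_bounds)+
      show "((\<lambda>x. \<epsilon> * \<phi> x) has_real_derivative \<epsilon> * \<phi>1 x) (at x)"
        "((\<lambda>x. \<epsilon> * \<phi>1 x) has_real_derivative \<epsilon> * \<phi>2 x) (at x)"
        "((\<lambda>x. \<epsilon> * \<psi> x) has_real_derivative \<epsilon> * \<psi>1 x) (at x)" for x
        by (intro DERIV_cmult d)+
      show "continuous_on UNIV (\<lambda>x. \<epsilon> * \<phi>2 x)" "continuous_on UNIV (\<lambda>x. \<epsilon> * \<psi>1 x)"
        by (intro continuous_intros cont)+
      show "(c has_real_derivative c' \<theta>) (at \<theta>)" "\<bar>c \<theta> - 1\<bar> \<le> 1/100" if "\<bar>\<theta>\<bar> < r" for \<theta>
        using c(1)[of \<theta>] r2(2)[of \<theta>] that by (simp_all add: r_def)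
      show "continuous_on {-r<..<r} c'" by (rule continuous_on_subset[OF c(2)]) (use r in auto)
      show "\<bar>c' \<theta>\<bar> \<le> A" if "\<bar>\<theta>\<bar> \<le> 3 * m" for \<theta>
      proof -
        have "\<bar>c' \<theta>\<bar> \<le> K * (3 * m) powr (q - 1)" using m m3 r that by (intro c') auto
        also have "\<dots> \<le> A" unfolding A_def by (intro mult_right_mono) auto
        finally show ?thesis .
      qed
      have "(3 * m) powr (q - 1) = \<epsilon> powr (q - 1) * (3 * M) powr (q - 1)"
        using powr_mult[of \<epsilon> "3 * M" "q - 1"] \<epsilon> M by (simp add: m_def mult.left_commute)
      then have "A * m = N * (\<epsilon> powr (q - 1) * \<epsilon>)" by (simp add: A_def N_def m_def)
      also have "\<epsilon> powr (q - 1) * \<epsilon> = \<epsilon> powr q" using \<epsilon> powr_add[of \<epsilon> "q - 1" 1] by simp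
      finally have "A * m * L = N * C * 4 * (\<epsilon> powr q * \<epsilon> powr (- q))" by (simp add: L_def)
      also have "\<epsilon> powr q * \<epsilon> powr (- q) = 1" using \<epsilon> by (simp flip: powr_add)
      finally show "A * m * L \<le> 1/800" using N by (simp add: C_def)
    qed (use m3 rU L0 in auto)
    then show ?thesis using lifespan_ge[of "L / 4"] L0 by (simp add: L_def)
  qed
  moreover have "0 < \<epsilon>0" "0 < C" using r M N by (auto simp: \<epsilon>0_def C_def)
  ultimately show ?thesis by (intro exI[of _ \<epsilon>0] conjI exI[of _ C] allI impI) auto
qed

text \<open>Descending induction on the order of the derivative, starting from the bound at order
  \<open>m\<close>: each lower derivative of order at least 1 vanishes at the origin, so the mean
  value inequality gains one factor |x|. As \<open>j < m\<close>, the descent ends at the first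
  derivative and does not reach \<open>c\<close> itself.\<close>

lemma Holder_vanishing_deriv_bound:
  fixes c :: "real \<Rightarrow> real"
  assumes diff: "times_differentiable_on m c U" and U: "ball 0 \<delta> \<subseteq> U" and \<alpha>: "0 \<le> \<alpha>" and K: "0 \<le> K"
    and top: "\<And>x. x \<in> U \<Longrightarrow> \<bar>(deriv ^^ m) c x\<bar> \<le> K * \<bar>x\<bar> powr \<alpha>"
    and zero: "\<And>k. 1 \<le> k \<Longrightarrow> k \<le> m \<Longrightarrow> (deriv ^^ k) c 0 = 0"
    and "j < m" "\<bar>x\<bar> < \<delta>"
  shows "\<bar>(deriv ^^ (m - j)) c x\<bar> \<le> K * \<bar>x\<bar> powr (\<alpha> + j)"
  using \<open>j < m\<close> \<open>\<bar>x\<bar> < \<delta>\<close>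
proof (induction j arbitrary: x)
  case 0
  then have "x \<in> U" using U by auto
  then show ?case using top[of x] by simp
next
  case (Suc j)
  define k where "k = m - Suc j"
  have k: "m - j = Suc k" "k < m" "1 \<le> k" using Suc.prems by (auto simp: k_def)
  \<comment> \<open>A symmetric interval contains both \<open>0\<close> and \<open>x\<close>
    whatever the sign of \<open>x\<close>.\<close>
  define S where "S = {- \<bar>x\<bar>..\<bar>x\<bar>}"
  have S: "y \<in> U" "\<bar>y\<bar> \<le> \<bar>x\<bar>" "\<bar>y\<bar> < \<delta>" if "y \<in> S" for y
  proof -
    show "\<bar>y\<bar> \<le> \<bar>x\<bar>" using that by (auto simp: S_def abs_le_iff)
    with Suc.prems show "\<bar>y\<bar> < \<delta>" by linarith
    then show "y \<in> U" using U by auto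
  qed
  have "norm ((deriv ^^ k) c x - (deriv ^^ k) c 0) \<le> K * \<bar>x\<bar> powr (\<alpha> + j) * norm (x - 0)"
  proof (rule field_differentiable_bound[where S=S])
    fix y assume y: "y \<in> S"
    show "((deriv ^^ k) c has_real_derivative (deriv ^^ Suc k) c y) (at y within S)"
      using times_differentiable_onD[OF diff k(2) S(1)[OF y]] by (rule has_field_derivative_at_within)
    have "\<bar>(deriv ^^ Suc k) c y\<bar> \<le> K * \<bar>y\<bar> powr (\<alpha> + j)"
      using Suc.IH[of y] Suc.prems S[OF y] k(1) by simp
    also have "\<dots> \<le> K * \<bar>x\<bar> powr (\<alpha> + j)"
      using S[OF y] \<alpha> K by (intro mult_left_mono powr_mono2) auto
    finally show "norm ((deriv ^^ Suc k) c y) \<le> K * \<bar>x\<bar> powr (\<alpha> + j)" by simp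
  qed (auto simp: S_def)
  also have "K * \<bar>x\<bar> powr (\<alpha> + j) * norm (x - 0) = K * \<bar>x\<bar> powr (\<alpha> + Suc j)"
    using powr_mult_base[of "\<bar>x\<bar>" "\<alpha> + j"] by (simp add: mult.commute add.commute add.left_commute)
  finally show ?case using zero[OF k(3)] k(2) unfolding k_def by simp
qed

text \<open>Serves the case \<open>m = 1\<close>, where continuity of \<open>deriv c\<close> comes
  from the Hoelder condition; for larger \<open>m\<close> it comes from differentiability.\<close>

lemma Holder_imp_continuous_on:
  fixes h :: "real \<Rightarrow> real"
  assumes "\<And>x y. x \<in> U \<Longrightarrow> y \<in> U \<Longrightarrow> \<bar>h x - h y\<bar> \<le> K * \<bar>x - y\<bar> powr \<alpha>" "0 < \<alpha>"
  shows "continuous_on U h"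
  unfolding continuous_on_def
proof
  fix x assume x: "x \<in> U"
  have "((\<lambda>y. \<bar>y - x\<bar>) \<longlongrightarrow> \<bar>x - x\<bar>) (at x within U)" by (intro tendsto_intros)
  then have "((\<lambda>y. \<bar>y - x\<bar> powr \<alpha>) \<longlongrightarrow> 0) (at x within U)"
    using assms(2) by (intro tendsto_zero_powrI[OF _ tendsto_const]) auto
  then have "((\<lambda>y. K * \<bar>y - x\<bar> powr \<alpha>) \<longlongrightarrow> 0) (at x within U)"
    using tendsto_mult_right_zero by blast
  then have "((\<lambda>y. h y - h x) \<longlongrightarrow> 0) (at x within U)"
    by (rule Lim_null_comparison[rotated])
      (use assms(1)[OF _ x] in \<open>auto simp: eventually_at_filter\<close>)
  then show "(h \<longlongrightarrow> h x) (at x within U)" by (simp add: LIM_zero_iff)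
qed

theorem theorem1:
  fixes U :: "real set" and c \<phi> \<psi> :: "real \<Rightarrow> real"
  assumes "open U" and "0 \<in> U"
    and "c 0 = 1" and "\<forall>\<theta>\<in>U. c \<theta> > 0"
    and "\<phi> \<in> C_bounded 2" and "\<psi> \<in> C_bounded 1"
  shows "(\<forall>p::real. p > 2 \<longrightarrow>
            c \<in> Holder_class (nat \<lceil>p - 2\<rceil>) (p - of_int \<lceil>p - 1\<rceil>) U \<longrightarrow>
            (\<forall>k\<in>{1..nat \<lceil>p - 2\<rceil>}. (deriv ^^ k) c 0 = 0) \<longrightarrow>
            (\<exists>\<epsilon>0>0. \<exists>C>0. \<forall>\<epsilon>::real. 0 < \<epsilon> \<and> \<epsilon> \<le> \<epsilon>0 \<longrightarrow>
               ereal (C * \<epsilon> powr (- (p - 1))) \<le> lifespan U c (\<lambda>x. \<epsilon> * \<phi> x) (\<lambda>x. \<epsilon> * \<psi> x)))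
       \<and> (c C1_differentiable_on U \<longrightarrow> deriv c 0 \<noteq> 0 \<longrightarrow>
            (\<exists>\<epsilon>0>0. \<exists>C>0. \<forall>\<epsilon>::real. 0 < \<epsilon> \<and> \<epsilon> \<le> \<epsilon>0 \<longrightarrow>
               ereal (C * \<epsilon> powr (- 1)) \<le> lifespan U c (\<lambda>x. \<epsilon> * \<phi> x) (\<lambda>x. \<epsilon> * \<psi> x)))"
proof (intro conjI allI impI)
  obtain \<delta> where \<delta>: "0 < \<delta>" "ball 0 \<delta> \<subseteq> U" using assms(1,2) open_contains_ball by blast
  have mem: "\<theta> \<in> U" if "\<bar>\<theta>\<bar> < \<delta>" for \<theta> using that \<delta>(2) by (auto simp: subset_iff)
  note bound = lifespan_lower_bound[where U=U and c=c and \<phi>=\<phi> and \<psi>=\<psi>, OF assms(1-3,5,6)]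
  {
    fix p :: real
    assume p: "p > 2" and H: "c \<in> Holder_class (nat \<lceil>p - 2\<rceil>) (p - of_int \<lceil>p - 1\<rceil>) U"
      and zero: "\<forall>k\<in>{1..nat \<lceil>p - 2\<rceil>}. (deriv ^^ k) c 0 = 0"
    define m where "m = nat \<lceil>p - 2\<rceil>"
    define \<alpha> where "\<alpha> = p - of_int \<lceil>p - 1\<rceil>"
    have m: "1 \<le> m" using p by (simp add: m_def) linarith
    have m_real: "real m = of_int \<lceil>p - 2\<rceil>" using p by (simp add: m_def)
    have "\<lceil>p - 1\<rceil> = \<lceil>p - 2\<rceil> + 1" using ceiling_add_of_int[of "p - 2" 1] by simp
    then have \<alpha>m: "\<alpha> = p - 1 - real m" by (simp add: \<alpha>_def m_real)
    \<comment> \<open>The ceiling of \<open>p - 2\<close> is strictly below \<open>p - 1\<close>;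
      for integer \<open>p\<close> the exponent is 1, not 0.\<close>
    have \<alpha>: "0 < \<alpha>" unfolding \<alpha>m m_real by linarith
    have diff: "times_differentiable_on m c U" using H by (simp add: Holder_class_def m_def)
    obtain K where K: "\<And>x y. x \<in> U \<Longrightarrow> y \<in> U \<Longrightarrow>
        \<bar>(deriv ^^ m) c x - (deriv ^^ m) c y\<bar> \<le> K * \<bar>x - y\<bar> powr \<alpha>"
      using H unfolding Holder_class_def m_def \<alpha>_def by blast
    \<comment> \<open>The Hoelder condition against the origin, where the derivative of order
      \<open>m\<close> vanishes since \<open>m \<ge> 1\<close>.\<close>
    have top: "\<bar>(deriv ^^ m) c x\<bar> \<le> \<bar>K\<bar> * \<bar>x\<bar> powr \<alpha>" if "x \<in> U" for x
    proof -
      have "\<bar>(deriv ^^ m) c x\<bar> \<le> K * \<bar>x\<bar> powr \<alpha>" using K[OF that assms(2)] zero m by (simp add: m_def)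
      also have "\<dots> \<le> \<bar>K\<bar> * \<bar>x\<bar> powr \<alpha>" by (intro mult_right_mono) auto
      finally show ?thesis .
    qed
    have "continuous_on U (deriv c)"
    proof (cases "m = 1")
      case True
      then show ?thesis using Holder_imp_continuous_on[of U "deriv c" K \<alpha>] K \<alpha> by simp
    next
      case False
      then have "(deriv c has_real_derivative (deriv ^^ 2) c x) (at x)" if "x \<in> U" for x
        using times_differentiable_onD[OF diff _ that, of 1] m by (simp add: numeral_2_eq_2)
      then show ?thesis by (intro continuous_at_imp_continuous_on) (auto intro: DERIV_isCont)
    qed
    then have cont: "continuous_on {-\<delta><..<\<delta>} (deriv c)"
      by (rule continuous_on_subset) (auto intro!: mem simp: abs_less_iff)
    show "\<exists>\<epsilon>0>0. \<exists>C>0. \<forall>\<epsilon>::real. 0 < \<epsilon> \<and> \<epsilon> \<le> \<epsilon>0 \<longrightarrow>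
        ereal (C * \<epsilon> powr (- (p - 1))) \<le> lifespan U c (\<lambda>x. \<epsilon> * \<phi> x) (\<lambda>x. \<epsilon> * \<psi> x)"
    proof (rule bound[OF \<delta>(1) _ cont])
      show "(c has_real_derivative deriv c \<theta>) (at \<theta>)" if "\<bar>\<theta>\<bar> < \<delta>" for \<theta>
        using times_differentiable_onD[OF diff _ mem[OF that], of 0] m by simp
      show "\<bar>deriv c \<theta>\<bar> \<le> \<bar>K\<bar> * b powr (p - 1 - 1)" if "0 < b" "b < \<delta>" "\<bar>\<theta>\<bar> \<le> b" for b \<theta>
      proof -
        \<comment> \<open>\<open>j = m - 1\<close> descends from order \<open>m\<close> to the first
          derivative; the exponent becomes \<open>\<alpha> + m - 1 = p - 2\<close>, that is
          \<open>q - 1\<close> for \<open>q = p - 1\<close>.\<close>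
        have "\<bar>(deriv ^^ (m - (m - 1))) c \<theta>\<bar> \<le> \<bar>K\<bar> * \<bar>\<theta>\<bar> powr (\<alpha> + real (m - 1))"
          by (rule Holder_vanishing_deriv_bound[OF diff \<delta>(2) _ _ top])
            (use \<alpha> zero m that in \<open>auto simp: m_def\<close>)
        also have "\<dots> \<le> \<bar>K\<bar> * b powr (\<alpha> + real (m - 1))"
          using that \<alpha> by (intro mult_left_mono powr_mono2) auto
        also have "\<alpha> + real (m - 1) = p - 1 - 1" using m by (simp add: \<alpha>m of_nat_diff)
        finally show ?thesis using m by simp
      qed
    qed
  }
  assume "c C1_differentiable_on U"
  then obtain D where D: "\<And>x. x \<in> U \<Longrightarrow> (c has_real_derivative D x) (at x)" "continuous_on U D"
    unfolding C1_differentiable_on_def by (auto simp: has_real_derivative_iff_has_vector_derivative)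
  have "isCont D 0" using D(2) assms(1,2) by (simp add: continuous_on_eq_continuous_at)
  then obtain d where d: "0 < d" "\<And>x. \<bar>x\<bar> < d \<Longrightarrow> \<bar>D x - D 0\<bar> < 1"
    using continuous_at_eps_delta[of 0 D] by (force simp: dist_real_def dest: spec[of _ 1])
  define r where "r = min d \<delta>"
  show "\<exists>\<epsilon>0>0. \<exists>C>0. \<forall>\<epsilon>::real. 0 < \<epsilon> \<and> \<epsilon> \<le> \<epsilon>0 \<longrightarrow>
      ereal (C * \<epsilon> powr (- 1)) \<le> lifespan U c (\<lambda>x. \<epsilon> * \<phi> x) (\<lambda>x. \<epsilon> * \<psi> x)"
  proof (rule bound[of r D "\<bar>D 0\<bar> + 1"])
    show "0 < r" using d \<delta> by (simp add: r_def)
    show "(c has_real_derivative D \<theta>) (at \<theta>)" if "\<bar>\<theta>\<bar> < r" for \<theta>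
      using that by (auto intro!: D mem simp: r_def)
    show "continuous_on {-r<..<r} D"
      by (rule continuous_on_subset[OF D(2)]) (auto intro!: mem simp: r_def abs_less_iff)
    \<comment> \<open>Here \<open>q - 1 = 0\<close>, and \<open>b powr 0 = 1\<close> because
      \<open>b > 0\<close>. A bound by powers of |\<theta>| would force \<open>D 0 = 0\<close>, as
      \<open>0 powr 0 = 0\<close>; this is why \<open>lifespan_lower_bound\<close> measures
      \<open>c'\<close> in terms of \<open>b\<close>.\<close>
    show "\<bar>D \<theta>\<bar> \<le> (\<bar>D 0\<bar> + 1) * b powr (1 - 1)" if "0 < b" "b < r" "\<bar>\<theta>\<bar> \<le> b" for b \<theta>
      using d(2)[of \<theta>] that by (simp add: r_def)
  qed
qed

end
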